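(* Let $\mathcal{P}=(V,E,r,\mu,\delta)$ be a DAG MPCS protocol specification for a contract $\mathfrak{C}$ with finite set of signers $A$. Then $\mathcal{P}$ is fair if and only if $\mathcal{P}$ has no abort-chaining sequence (AC sequence).
   Context: **Causality.** For a finite directed acyclic graph $(V,E)$ and $v,w\in V$, $v\prec w$ means there is a directed path (of length $\ge 1$) from $v$ to $w$; $v\preceq w$ means $v\prec w$ or $v=w$. This extends to $V\cup E$: $(v,w)\prec(v',w')$ iff $w\preceq v'$; $v\prec(v',w')$ iff $v\preceq v'$; $(v,w)\prec v'$ iff $w\preceq v'$. A set $S\subseteq V\cup E$ is causally closed if $x\in S$ and $y\prec x$ imply $y\in S$. $\mathrm{in}(v)$ is the set of edges with target $v$. **DAG protocol specification.** Let $R$ be a set of roles, $T\notin R$ the trusted third party (TTP), $M$ a set of messages, $\varepsilon,\mathit{exit}\notin M$ two symbols. A DAG protocol specification is $\mathcal{P}=(V,E,r,\mu,\delta)$ with $(V,E)$ a finite DAG, $r:V\to R\cup\{T\}$, $\mu:E\to M\cup\{\varepsilon,\mathit{exit}\}$ such that $\mu(v,v')=\varepsilon$ implies $r(v)=r(v')$ and $\mu(v,v')=\mathit{exit}$ implies $r(v')=T$, and $\delta:M^*\to M$ a function giving the replies of the TTP. Edges with label in $M$ are message edges. **DAG MPCS protocol specification.** Let $A\subset R$ be a finite set of signers, $\mathfrak{C}$ a contract, $\mathit{SigSet}\subseteq V$. $\mathcal{P}$ is a DAG MPCS protocol specification for $\mathfrak{C}$ if: 1. there is a unique $v_T\in V$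 with $r(v_T)=T$, $(v,v_T)\in E$ for all $v\in V\setminus\{v_T\}$, and $r(v)\in A$ for $v\ne v_T$; 2. for all $v,w\in V$: if $v\prec w$ then $(v,w)\in E$ or there is $u\in V$ with $v\prec u\prec w$ and $r(u)\in\{r(v),r(w)\}$; 3. for $(v,w)\in E$: $\mu(v,w)=\varepsilon$ if $r(v)=r(w)$; $\mu(v,w)=\mathit{exit}$ if $w=v_T$; $\mu(v,w)$ is the signature $\mathcal{S}_{r(v)}(\mathfrak{C})$ if $v\in\mathit{SigSet}$ and $r(v)\ne r(w)\ne T$; otherwise $\mu(v,w)$ is the promise $\wp_{r(v)}(\mathfrak{C},v,r(w),T)$ (both kinds are elements of $M$); 4. $\delta$ takes values in $\{\text{"abort"},(\mathcal{S}_Q(\mathfrak{C}))_{Q\in A}\}$ and is given by the TTP procedure below. $\mathit{SigSet}(\mathcal{P})$ is the set of $v\in\mathit{SigSet}$ having at least one outgoing message edge. For $v\in V\setminus\{v_T\}$: $K(v)=\{(w,v')\in E: \mu(w,v')\in M,\ v'\preceq v,\ r(v')=r(v)\}$ and $K_\prec(v)=\{(w,v')\in K(v): v'\prec v\}$; $K_\prec(S)=\bigcup_{v\in S}K_\prec(v)$. $v\in\mathit{InitSet}(\mathcal{P})$ iff $\{r(w): (w,v')\in K_\prec(v)\}\cup\{r(v)\}\neq A$. $v\in\mathit{EndSet}(\mathcal{P})$ iff $\{r(w): (w,v')\in K(v),\ w\in\mathit{SigSet}(\mathcal{P})\}\cup\{r(v)\}=A$. **TTP procedure.** Taking the exit edge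 $(v,v_T)$ means that signer $r(v)$ sends to $T$ the message $p_v$ consisting of the promise $\wp_{r(v)}(\mathfrak{C},v,r(v),T)$ and the list of labels of all edges in $K_\prec(v)$. $T$ keeps sets $I\subseteq V$, $\mathit{Dishonest}\subseteq A$ (initially empty) and a value $\mathit{decision}$ (initially "abort"). A message that does not consist of a promise $\wp_P(\mathfrak{C},v,P,T)$ followed by a list is answered by "abort". Otherwise: (a) if $P\in\mathit{Dishonest}$, or the message is not equal to $p_w$ for any $w\in V$, or some $w'\in I$ has $r(w')=P$, add $P$ to $\mathit{Dishonest}$ and reply "abort"; (b) otherwise put $I:=I\cup\{v\}$; if $v\notin\mathit{InitSet}(\mathcal{P})$, then first for every $w\in I$ for which there is $(w',x)\in K_\prec(I)$ with $w\prec(w',x)$ and $r(w')=r(w)$, add $r(w)$ to $\mathit{Dishonest}$, and afterwards, if every $w\in I$ with $r(w)\notin\mathit{Dishonest}$ has $r(w)=P$, set $\mathit{decision}:=(\mathcal{S}_Q(\mathfrak{C}))_{Q\in A}$; finally reply $\mathit{decision}$. $\delta(m_1,\dots,m_n)$ is the reply to the last message of the sequence. **Executions.** A state is a set $s\subseteq V\cup E$; the initial state is $s_0=\emptyset$. Transitions $s\to s'$ with $s\ne s'$ are: ($\mathit{recv}$) $s'=s\cup\{v\}$ with $v\in V$, $\mathrm{in}(v)\subseteq s$; ($\mathit{send}$) $s'=s\cup\{e\}$ with $\mu(e)\in M$; ($\varepsilon$) $s'=s\cup\{e\}$ with $e=(v,v')$, $\mu(e)=\varepsilon$, $v\in s$;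 ($\mathit{exit}$) $s'=s\cup\{e\}$ with $\mu(e)=\mathit{exit}$. Thus send and exit events can occur at any time, and a dishonest signer is limited only by these rules. An execution is a finite sequence of states and transition labels $[s_0,\alpha_1,s_1,\dots,\alpha_l,s_l]$ starting in $s_0$ whose consecutive states are related by transitions. The replies of $T$ in an execution are those of the TTP procedure applied to the messages $p_v$ of its exit transitions, in the order in which these occur. **Honesty.** For a role $P$ let $E_P$ be the set of edges having an endpoint of role $P$, and $V_P$ the set of endpoints of edges in $E_P$. Signer $P$ is honest in an execution if for every state $s_i$ of it the set $s=s_i\cap(V_P\cup E_P)$ satisfies, with causal closedness taken in the graph $(V_P,E_P)$: (1) $s$ contains at most one exit edge; (2) if $s$ contains no exit edge, $s$ is causally closed; (3) if $s$ contains an exit edge $e=(v,w)$, then $v\notin s$ and $s\setminus\{e\}$ is causally closed. **Fairness.** An execution with final state $s_n$ is fair for signer $P$ if at least one of the following holds: (i) no signer has received signatures from $T$ (no reply of $T$ in the execution is a list of signatures), and $P$ has not sent a signature (no message edge $(v,w)\in s_n$ with $r(v)=P$ has $v\in\mathit{SigSet}(\mathcal{P})$); (ii) there is $v\in s_n\cap\mathit{EndSet}(\mathcal{P})$ with $r(v)=P$; (iii) $P$ has not received "abort" from $T$, i.e. for each exit edge $(v,v_T)\in s_n$ with $r(v)=P$, the reply of $T$ at the moment this edge was executed is not "abort". $\mathcal{P}$ is fair if every execution is fair for every signer that is honest in it. **AC sequence.** For $v\in V$, $I\subseteq V$ let $\mathrm{hon}(v,I)$ be the statement: there is no $(x,y)\in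 K_\prec(I)$ with $v\prec(x,y)$ and $r(x)=r(v)$. A sequence $(v_1,\dots,v_l\mid s)$ of vertices in $V\setminus\{v_T\}$, $1\le l\le|A|$, is an AC sequence for $\mathcal{P}$ if: 1. $v_1\in\mathit{InitSet}(\mathcal{P})$; 2. $r(v_i)\ne r(v_j)$ for $i\ne j$; 3. for all $i\le l$: $\mathrm{hon}(v_i,\{v_1,\dots,v_i\})$, and, if $i\geq 2$, $\mathrm{hon}(v_{i-1},\{v_1,\dots,v_i\})$; 4. every $v\prec v_l$ with $r(v)=r(v_l)$ satisfies $v\notin\mathit{EndSet}(\mathcal{P})$; 5. $s\in\mathit{SigSet}(\mathcal{P})\setminus\mathit{EndSet}(\mathcal{P})$, $r(s)=r(v_l)$ and $v_l\not\preceq s$.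
   Formalization: Fairness for an honest signer P is required only in executions where every message of P listed in a p_v sent to T was already sent by P (its edge is in the current state); without this, others could convict P with promises P never sent and the stated equivalence is false. *)

theory Defs
  imports Main
begin

section \<open>Causality\<close>

datatype 'v item = Vertex 'v | Edge "'v \<times> 'v"

definition items :: "'v set \<Rightarrow> ('v \<times> 'v) set \<Rightarrow> 'v item set" where
  "items V E = Vertex ` V \<union> Edge ` E"

text \<open>For vertices, \<open>v \<prec> w\<close> is \<open>(v, w) \<in> E\<^sup>+\<close> and \<open>v \<preceq> w\<close> is \<open>(v, w) \<in> E\<^sup>*\<close>.\<close>

fun prec :: "('v \<times> 'v) set \<Rightarrow> 'v item \<Rightarrow> 'v item \<Rightarrow> bool" where
  "prec E (Vertex v) (Vertex w) \<longleftrightarrow> (v, w) \<in> E\<^sup>+"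
| "prec E (Vertex v) (Edge (v', w')) \<longleftrightarrow> (v, v') \<in> E\<^sup>*"
| "prec E (Edge (v, w)) (Vertex v') \<longleftrightarrow> (w, v') \<in> E\<^sup>*"
| "prec E (Edge (v, w)) (Edge (v', w')) \<longleftrightarrow> (w, v') \<in> E\<^sup>*"

definition causally_closed :: "'v set \<Rightarrow> ('v \<times> 'v) set \<Rightarrow> 'v item set \<Rightarrow> bool" where
  "causally_closed V E S \<longleftrightarrow>
     S \<subseteq> items V E \<and> (\<forall>x\<in>S. \<forall>y\<in>items V E. prec E y x \<longrightarrow> y \<in> S)"


section \<open>Protocol specifications and their executions\<close>

text \<open>The type \<open>'m\<close> is the set of messages; the two symbols outside of it are added
  by the following datatype.\<close>

datatype 'm label = Msg (content: 'm) | Eps | Exit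

definition is_message :: "'m label \<Rightarrow> bool" where
  "is_message l \<longleftrightarrow> (\<exists>m. l = Msg m)"

datatype transition = Recv_step | Send_step | Eps_step | Exit_step

locale dag_protocol =
  fixes R :: "'p set" and T :: 'p
    and V :: "'v set" and E :: "('v \<times> 'v) set"
    and r :: "'v \<Rightarrow> 'p" and \<mu> :: "'v \<times> 'v \<Rightarrow> 'm label" and \<delta> :: "'m list \<Rightarrow> 'm"
  assumes T_notin_R: "T \<notin> R"
    and finite_V: "finite V"
    and E_subset: "E \<subseteq> V \<times> V"
    and acyclic_E: "acyclic E"
    and role_range: "r ` V \<subseteq> R \<union> {T}"
    and eps_label: "\<And>v w. (v, w) \<in> E \<Longrightarrow> \<mu> (v, w) = Eps \<Longrightarrow> r v = r w"
    and exit_label: "\<And>v w. (v, w) \<in> E \<Longrightarrow> \<mu> (v, w) = Exit \<Longrightarrow> r w = T"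
begin

definition step :: "'v item set \<Rightarrow> transition \<Rightarrow> 'v item set \<Rightarrow> bool" where
  "step s \<alpha> s' \<longleftrightarrow> s \<noteq> s' \<and>
     (case \<alpha> of
        Recv_step \<Rightarrow> \<exists>v\<in>V. {Edge (u, v) | u. (u, v) \<in> E} \<subseteq> s \<and> s' = s \<union> {Vertex v}
      | Send_step \<Rightarrow> \<exists>e\<in>E. is_message (\<mu> e) \<and> s' = s \<union> {Edge e}
      | Eps_step \<Rightarrow> \<exists>v w. (v, w) \<in> E \<and> \<mu> (v, w) = Eps \<and> Vertex v \<in> s \<and> s' = s \<union> {Edge (v, w)}
      | Exit_step \<Rightarrow> \<exists>e\<in>E. \<mu> e = Exit \<and> s' = s \<union> {Edge e})"

text \<open>An execution \<open>[s\<^sub>0, \<alpha>\<^sub>1, s\<^sub>1, \<dots>, \<alpha>\<^sub>l, s\<^sub>l]\<close> is given by the list \<open>ss\<close> of its states and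
  the list \<open>as\<close> of its transition labels, so that \<open>as ! i\<close> leads from \<open>ss ! i\<close> to \<open>ss ! Suc i\<close>.\<close>

definition execution :: "'v item set list \<Rightarrow> transition list \<Rightarrow> bool" where
  "execution ss as \<longleftrightarrow> length ss = Suc (length as) \<and> ss ! 0 = {} \<and>
     (\<forall>i<length as. step (ss ! i) (as ! i) (ss ! Suc i))"

definition role_edges :: "'p \<Rightarrow> ('v \<times> 'v) set" where
  "role_edges P = {(v, w) \<in> E. r v = P \<or> r w = P}"

definition role_verts :: "'p \<Rightarrow> 'v set" where
  "role_verts P = fst ` role_edges P \<union> snd ` role_edges P"

definition honest_state :: "'p \<Rightarrow> 'v item set \<Rightarrow> bool" where
  "honest_state P s_full \<longleftrightarrow>
     (let s = s_full \<inter> items (role_verts P) (role_edges P);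
          exits = {e \<in> E. \<mu> e = Exit \<and> Edge e \<in> s}
      in (\<forall>e\<in>exits. \<forall>e'\<in>exits. e = e') \<and>
         (exits = {} \<longrightarrow> causally_closed (role_verts P) (role_edges P) s) \<and>
         (\<forall>(v, w)\<in>exits. Vertex v \<notin> s \<and>
            causally_closed (role_verts P) (role_edges P) (s - {Edge (v, w)})))"

definition honest :: "'p \<Rightarrow> 'v item set list \<Rightarrow> bool" where
  "honest P ss \<longleftrightarrow> (\<forall>s\<in>set ss. honest_state P s)"

end


section \<open>Contract signing protocols\<close>

text \<open>\<open>promise P c v Q T\<close> is the promise \<open>\<wp>\<^sub>P(c, v, Q, T)\<close> and \<open>signature P c\<close> the signature
  \<open>\<S>\<^sub>P(c)\<close>; \<open>msg_list\<close> packs a list of messages into one message. The assumptions say that the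
  TTP can read off the issuer and the vertex of a promise, can take lists apart, and that
  a list of signatures is not an abort message.\<close>

locale message_algebra =
  fixes promise :: "'p \<Rightarrow> 'c \<Rightarrow> 'v \<Rightarrow> 'p \<Rightarrow> 'p \<Rightarrow> 'm"
    and signature :: "'p \<Rightarrow> 'c \<Rightarrow> 'm"
    and abort :: 'm
    and msg_list :: "'m list \<Rightarrow> 'm"
  assumes promise_inject:
      "\<And>P c v Q U P' c' v' Q' U'.
         promise P c v Q U = promise P' c' v' Q' U' \<Longrightarrow> P = P' \<and> v = v'"
    and msg_list_inject: "inj msg_list"
    and abort_not_list: "abort \<notin> range msg_list"

text \<open>An arbitrary but fixed enumeration of a finite set.\<close>

definition enum :: "'a set \<Rightarrow> 'a list" where
  "enum S = (SOME xs. distinct xs \<and> set xs = S)"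

record ('v, 'p, 'm) ttp_state =
  evidence :: "'v set"
  dishonest :: "'p set"
  decision :: 'm

locale contract_setup =
  dag_protocol R T V E r \<mu> \<delta> + message_algebra promise signature abort msg_list
  for R :: "'p set" and T :: 'p
    and V :: "'v set" and E :: "('v \<times> 'v) set"
    and r :: "'v \<Rightarrow> 'p" and \<mu> :: "'v \<times> 'v \<Rightarrow> 'm label" and \<delta> :: "'m list \<Rightarrow> 'm"
    and promise :: "'p \<Rightarrow> 'c \<Rightarrow> 'v \<Rightarrow> 'p \<Rightarrow> 'p \<Rightarrow> 'm"
    and signature :: "'p \<Rightarrow> 'c \<Rightarrow> 'm"
    and abort :: 'm
    and msg_list :: "'m list \<Rightarrow> 'm" +
  fixes A :: "'p set" and C :: 'c and SigSet :: "'v set"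
  assumes finite_A: "finite A"
    and A_subset: "A \<subseteq> R"
    and SigSet_subset: "SigSet \<subseteq> V"
begin

definition v\<^sub>T :: 'v where
  "v\<^sub>T = (THE v. v \<in> V \<and> r v = T)"

text \<open>This is \<open>SigSet(\<P>)\<close>, as opposed to the parameter \<^term>\<open>SigSet\<close>.\<close>

definition active_SigSet :: "'v set" where
  "active_SigSet = {v \<in> SigSet. \<exists>w. (v, w) \<in> E \<and> is_message (\<mu> (v, w))}"

definition K :: "'v \<Rightarrow> ('v \<times> 'v) set" where
  "K v = {(w, v') \<in> E. is_message (\<mu> (w, v')) \<and> (v', v) \<in> E\<^sup>* \<and> r v' = r v}"

definition K_prec :: "'v \<Rightarrow> ('v \<times> 'v) set" where
  "K_prec v = {(w, v') \<in> K v. (v', v) \<in> E\<^sup>+}"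

definition K_prec_set :: "'v set \<Rightarrow> ('v \<times> 'v) set" where
  "K_prec_set S = (\<Union>v\<in>S. K_prec v)"

definition InitSet :: "'v set" where
  "InitSet = {v \<in> V - {v\<^sub>T}. {r w | w v'. (w, v') \<in> K_prec v} \<union> {r v} \<noteq> A}"

definition EndSet :: "'v set" where
  "EndSet = {v \<in> V - {v\<^sub>T}.
     {r w | w v'. (w, v') \<in> K v \<and> w \<in> active_SigSet} \<union> {r v} = A}"

definition hon :: "'v \<Rightarrow> 'v set \<Rightarrow> bool" where
  "hon v I \<longleftrightarrow> \<not> (\<exists>x y. (x, y) \<in> K_prec_set I \<and> prec E (Vertex v) (Edge (x, y)) \<and> r x = r v)"


subsection \<open>The TTP procedure\<close>

definition request :: "'v \<Rightarrow> 'm" where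
  "request v = msg_list (promise (r v) C v (r v) T # map (content \<circ> \<mu>) (enum (K_prec v)))"

definition signatures :: 'm where
  "signatures = msg_list (map (\<lambda>Q. signature Q C) (enum A))"

definition ttp_init :: "('v, 'p, 'm) ttp_state" where
  "ttp_init = \<lparr>evidence = {}, dishonest = {}, decision = abort\<rparr>"

definition promise_by :: "'m \<Rightarrow> 'p \<Rightarrow> 'v \<Rightarrow> bool" where
  "promise_by m P v \<longleftrightarrow> P \<in> A \<and> (\<exists>ms. m = msg_list (promise P C v P T # ms))"

definition ttp_accept :: "'p \<Rightarrow> 'v \<Rightarrow> ('v, 'p, 'm) ttp_state \<Rightarrow> ('v, 'p, 'm) ttp_state" where
  "ttp_accept P v st =
     (let I = insert v (evidence st) in
      if v \<in> InitSet then st\<lparr>evidence := I\<rparr>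
      else
        (let D = dishonest st \<union> {r w | w. w \<in> I \<and> \<not> hon w I} in
         \<lparr>evidence = I, dishonest = D,
          decision = (if \<forall>w\<in>I. r w \<notin> D \<longrightarrow> r w = P then signatures else decision st)\<rparr>))"

text \<open>By \<open>promise_inject\<close> and \<open>msg_list_inject\<close> the definite description is well-defined.
  Moreover \<open>m = request w\<close> entails \<open>w = v\<close> and \<open>r v = P\<close>.\<close>

definition ttp_step :: "'m \<Rightarrow> ('v, 'p, 'm) ttp_state \<Rightarrow> 'm \<times> ('v, 'p, 'm) ttp_state" where
  "ttp_step m st =
     (if \<not> (\<exists>P v. promise_by m P v) then (abort, st)
      else
        (let (P, v) = (THE (P, v). promise_by m P v) in
         if P \<in> dishonest st \<or> (\<forall>w\<in>V. m \<noteq> request w) \<or> (\<exists>w\<in>evidence st. r w = P)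
         then (abort, st\<lparr>dishonest := insert P (dishonest st)\<rparr>)
         else (let st' = ttp_accept P v st in (decision st', st'))))"

definition ttp_run :: "'m list \<Rightarrow> ('v, 'p, 'm) ttp_state" where
  "ttp_run ms = fold (\<lambda>m st. snd (ttp_step m st)) ms ttp_init"

definition ttp_reply :: "'m list \<Rightarrow> 'm" where
  "ttp_reply ms = fst (ttp_step (last ms) (ttp_run (butlast ms)))"


subsection \<open>Replies of the TTP in an execution\<close>

text \<open>A transition adds exactly one item to the state; for an exit transition this is the exit
  edge, whose source is the \<open>exit_vertex\<close>.\<close>

definition exit_vertex :: "'v item set list \<Rightarrow> nat \<Rightarrow> 'v" where
  "exit_vertex ss i = (THE v. \<exists>w. Edge (v, w) \<in> ss ! Suc i - ss ! i)"

definition requests :: "'v item set list \<Rightarrow> transition list \<Rightarrow> nat \<Rightarrow> 'm list" where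
  "requests ss as n =
     map (\<lambda>i. request (exit_vertex ss i)) (filter (\<lambda>i. as ! i = Exit_step) [0..<n])"

text \<open>Only meaningful if transition \<open>i\<close> is an exit transition.\<close>

definition reply :: "'v item set list \<Rightarrow> transition list \<Rightarrow> nat \<Rightarrow> 'm" where
  "reply ss as i = \<delta> (requests ss as (Suc i))"


subsection \<open>Fairness\<close>

definition fair_for :: "'p \<Rightarrow> 'v item set list \<Rightarrow> transition list \<Rightarrow> bool" where
  "fair_for P ss as \<longleftrightarrow>
     ((\<forall>i<length as. as ! i = Exit_step \<longrightarrow> reply ss as i \<noteq> signatures) \<and>
      \<not> (\<exists>v w. (v, w) \<in> E \<and> is_message (\<mu> (v, w)) \<and> Edge (v, w) \<in> last ss \<and>
              r v = P \<and> v \<in> active_SigSet)) \<or>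
     (\<exists>v. Vertex v \<in> last ss \<and> v \<in> EndSet \<and> r v = P) \<or>
     (\<forall>v. Edge (v, v\<^sub>T) \<in> last ss \<and> r v = P \<longrightarrow>
        (\<forall>i<length as. as ! i = Exit_step \<and> Edge (v, v\<^sub>T) \<in> ss ! Suc i - ss ! i \<longrightarrow>
           reply ss as i \<noteq> abort))"

text \<open>Promises and signatures of \<open>P\<close> can only be created by \<open>P\<close>: whenever some signer
  presents messages of \<open>P\<close> to the TTP, \<open>P\<close> has sent them before. The transition rules and
  \<^const>\<open>honest\<close> do not express this, because exit transitions are unconditional and an exit edge
  of another signer does not belong to \<^term>\<open>role_edges P\<close>. Without it, a signer could convict
  an honest \<open>P\<close> by a message that \<open>P\<close> never sent.\<close>

definition unforged :: "'p \<Rightarrow> 'v item set list \<Rightarrow> transition list \<Rightarrow> bool" where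
  "unforged P ss as \<longleftrightarrow>
     (\<forall>i<length as. as ! i = Exit_step \<longrightarrow>
        (\<forall>(w, x)\<in>K_prec (exit_vertex ss i). r w = P \<longrightarrow> Edge (w, x) \<in> ss ! i))"

definition fair :: bool where
  "fair \<longleftrightarrow>
     (\<forall>ss as. execution ss as \<longrightarrow>
        (\<forall>P\<in>A. honest P ss \<and> unforged P ss as \<longrightarrow> fair_for P ss as))"


subsection \<open>Abort-chaining sequences\<close>

text \<open>The sequence \<open>(v\<^sub>1, \<dots>, v\<^sub>l | s)\<close> is given by the list \<open>vs\<close> of the \<open>v\<^sub>i\<close> and by \<open>s\<close>; here
  \<open>v\<^sub>i\<close> is \<open>vs ! (i - 1)\<close>, and \<open>{v\<^sub>1, \<dots>, v\<^sub>i}\<close> is \<open>set (take i vs)\<close>.\<close>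

definition AC_sequence :: "'v list \<Rightarrow> 'v \<Rightarrow> bool" where
  "AC_sequence vs s \<longleftrightarrow>
     set vs \<subseteq> V - {v\<^sub>T} \<and> 1 \<le> length vs \<and> length vs \<le> card A \<and>
     hd vs \<in> InitSet \<and>
     (\<forall>i<length vs. \<forall>j<length vs. i \<noteq> j \<longrightarrow> r (vs ! i) \<noteq> r (vs ! j)) \<and>
     (\<forall>i\<in>{1..length vs}. hon (vs ! (i - 1)) (set (take i vs)) \<and>
        (2 \<le> i \<longrightarrow> hon (vs ! (i - 2)) (set (take i vs)))) \<and>
     (\<forall>v\<in>V. (v, last vs) \<in> E\<^sup>+ \<and> r v = r (last vs) \<longrightarrow> v \<notin> EndSet) \<and>
     s \<in> active_SigSet - EndSet \<and> r s = r (last vs) \<and> (last vs, s) \<notin> E\<^sup>*"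

end

locale dag_mpcs =
  contract_setup R T V E r \<mu> \<delta> promise signature abort msg_list A C SigSet
  for R :: "'p set" and T :: 'p
    and V :: "'v set" and E :: "('v \<times> 'v) set"
    and r :: "'v \<Rightarrow> 'p" and \<mu> :: "'v \<times> 'v \<Rightarrow> 'm label" and \<delta> :: "'m list \<Rightarrow> 'm"
    and promise :: "'p \<Rightarrow> 'c \<Rightarrow> 'v \<Rightarrow> 'p \<Rightarrow> 'p \<Rightarrow> 'm"
    and signature :: "'p \<Rightarrow> 'c \<Rightarrow> 'm"
    and abort :: 'm
    and msg_list :: "'m list \<Rightarrow> 'm"
    and A :: "'p set" and C :: 'c and SigSet :: "'v set" +
  assumes unique_ttp: "\<exists>!v. v \<in> V \<and> r v = T"
    and exit_edges: "\<And>v. v \<in> V - {v\<^sub>T} \<Longrightarrow> (v, v\<^sub>T) \<in> E"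
    and signer_roles: "\<And>v. v \<in> V - {v\<^sub>T} \<Longrightarrow> r v \<in> A"
    and density: "\<And>v w. v \<in> V \<Longrightarrow> w \<in> V \<Longrightarrow> (v, w) \<in> E\<^sup>+ \<Longrightarrow>
       (v, w) \<in> E \<or> (\<exists>u\<in>V. (v, u) \<in> E\<^sup>+ \<and> (u, w) \<in> E\<^sup>+ \<and> r u \<in> {r v, r w})"
    and labels: "\<And>v w. (v, w) \<in> E \<Longrightarrow> \<mu> (v, w) =
       (if r v = r w then Eps
        else if w = v\<^sub>T then Exit
        else if v \<in> SigSet then Msg (signature (r v) C)
        else Msg (promise (r v) C v (r w) T))"
    and ttp_range: "\<And>ms. \<delta> ms \<in> {abort, signatures}"
    and ttp_procedure: "\<And>ms. ms \<noteq> [] \<Longrightarrow> \<delta> ms = ttp_reply ms"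

end

theory Submission
  imports Defs
begin

text \<open>If an honest \<open>P\<close> is treated unfairly, then the TTP has answered its exit at some vertex \<open>v\<close>
  with an abort. Causal closure and unforgeability prevent \<open>P\<close> from ever being convicted, so
  the TTP keeps aborting, and unfairness means that \<open>P\<close> has sent a signature. An accepted
  request from outside \<open>InitSet\<close> is aborted only because of an earlier one whose sender still looks
  honest; following these reasons back to \<open>InitSet\<close> gives the chain that ends in \<open>v\<close>.
  Conversely, for an AC sequence \<open>(v\<^sub>1, \<dots>, v\<^sub>l | s)\<close> one executes the causal past of a signature sent
  from \<open>s\<close> and of all messages of \<open>P = r v\<^sub>l\<close> known at the \<open>v\<^sub>i\<close>, and then takes the exits at
  \<open>v\<^sub>1, \<dots>, v\<^sub>l\<close> in this order: each request vouches for the abort of the next one.\<close>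

context dag_mpcs
begin

subsection \<open>Signers, roles and causality\<close>

lemma role_v\<^sub>T: "r v\<^sub>T = T"
  using theI'[OF unique_ttp] unfolding v\<^sub>T_def by auto

lemma T_notin_A: "T \<notin> A"
  using A_subset T_notin_R by auto

lemma edge_in_V: "(v, w) \<in> E \<Longrightarrow> v \<in> V \<and> w \<in> V"
  using E_subset by auto

lemma rtrancl_in_V: "(v, w) \<in> E\<^sup>* \<Longrightarrow> w \<in> V \<Longrightarrow> v \<in> V"
  by (induction rule: converse_rtrancl_induct) (auto dest: edge_in_V)

lemma prec_irrefl: "(v, v) \<notin> E\<^sup>+"
  using acyclic_E by (simp add: acyclic_def)

lemma finite_E: "finite E"
  using finite_V E_subset by (meson finite_SigmaI finite_subset)

lemma wf_prec: "wf (E\<^sup>+)"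
  using finite_E acyclic_E by (simp add: finite_acyclic_wf wf_trancl)

lemma wf_succ: "wf ((E\<inverse>)\<^sup>+)"
  using finite_E acyclic_E by (simp add: finite_acyclic_wf_converse wf_trancl)

text \<open>An edge leaving \<open>v\<^sub>T\<close> would close a cycle with the exit edge of its
  target.\<close>

lemma v\<^sub>T_sink: "(v\<^sub>T, w) \<notin> E"
proof
  assume e: "(v\<^sub>T, w) \<in> E"
  show False
  proof (cases "w = v\<^sub>T")
    case True then show False using e prec_irrefl by blast
  next
    case False
    then have "(w, v\<^sub>T) \<in> E" using e edge_in_V exit_edges by auto
    then show False using e prec_irrefl by (meson r_into_trancl trancl_trans)
  qed
qed

lemma edge_source: "(v, w) \<in> E \<Longrightarrow> v \<in> V - {v\<^sub>T}"
  using edge_in_V v\<^sub>T_sink by auto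

lemma signer_iff: "v \<in> V \<Longrightarrow> v \<noteq> v\<^sub>T \<longleftrightarrow> r v \<in> A"
  using signer_roles role_v\<^sub>T T_notin_A by auto

text \<open>Sources of edges are signers, whose role differs from \<open>T\<close>, so the
  \<open>Eps\<close> case of \<open>labels\<close> never catches an edge into
  \<open>v\<^sub>T\<close>.\<close>

lemma exit_iff: "(v, w) \<in> E \<Longrightarrow> \<mu> (v, w) = Exit \<longleftrightarrow> w = v\<^sub>T"
  using labels[of v w] signer_roles[OF edge_source, of v w] role_v\<^sub>T T_notin_A by auto

lemma message_iff: "(v, w) \<in> E \<Longrightarrow> is_message (\<mu> (v, w)) \<longleftrightarrow> r v \<noteq> r w \<and> w \<noteq> v\<^sub>T"
  using labels[of v w] unfolding is_message_def by auto


section \<open>Paths inside one role\<close>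

definition local_edges :: "'p \<Rightarrow> ('v \<times> 'v) set" where
  "local_edges P = {(a, b) \<in> E. r a = P \<and> r b = P}"

lemma local_rtrancl_prec: "(v, w) \<in> (local_edges P)\<^sup>* \<Longrightarrow> (v, w) \<in> E\<^sup>*"
  using rtrancl_mono[of "local_edges P" E] by (auto simp: local_edges_def)

lemma local_rtrancl_role: "(v, w) \<in> (local_edges P)\<^sup>* \<Longrightarrow> r v = P \<longleftrightarrow> r w = P"
  by (induction rule: rtrancl_induct) (auto simp: local_edges_def)

text \<open>\<open>density\<close> can be iterated until at most one edge changes the role: the path
  stays in the role of \<open>v\<close>, crosses once, then stays in the role of \<open>w\<close>.
  The induction is on the number of vertices strictly between \<open>v\<close> and
  \<open>w\<close>.\<close>

lemma role_factorization:
  assumes "(v, w) \<in> E\<^sup>+"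
  shows "\<exists>a b. (v, a) \<in> (local_edges (r v))\<^sup>* \<and> (a, b) \<in> E \<and> (b, w) \<in> (local_edges (r w))\<^sup>*"
  using assms
proof (induction "card {u \<in> V. (v, u) \<in> E\<^sup>+ \<and> (u, w) \<in> E\<^sup>+}" arbitrary: v w rule: less_induct)
  case less
  have V: "v \<in> V" "w \<in> V"
    using less.prems E_subset by (auto dest: tranclD tranclD2)
  show ?case
  proof (cases "(v, w) \<in> E")
    case True
    then show ?thesis by blast
  next
    case False
    then obtain u where u: "u \<in> V" "(v, u) \<in> E\<^sup>+" "(u, w) \<in> E\<^sup>+" "r u = r v \<or> r u = r w"
      using density[OF V less.prems] by auto
    \<comment> \<open>\<open>u\<close> lies between \<open>v\<close> and \<open>w\<close> but, by
      acyclicity, not between \<open>v\<close> and itself, so the count drops.\<close>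
    have "card {z \<in> V. (v, z) \<in> E\<^sup>+ \<and> (z, u) \<in> E\<^sup>+} < card {z \<in> V. (v, z) \<in> E\<^sup>+ \<and> (z, w) \<in> E\<^sup>+}"
      using u prec_irrefl finite_V by (intro psubset_card_mono psubsetI) (auto intro: trancl_trans)
    from less.hyps[OF this u(2)] obtain a b where 1:
      "(v, a) \<in> (local_edges (r v))\<^sup>*" "(a, b) \<in> E" "(b, u) \<in> (local_edges (r u))\<^sup>*" by blast
    have "card {z \<in> V. (u, z) \<in> E\<^sup>+ \<and> (z, w) \<in> E\<^sup>+} < card {z \<in> V. (v, z) \<in> E\<^sup>+ \<and> (z, w) \<in> E\<^sup>+}"
      using u prec_irrefl finite_V by (intro psubset_card_mono psubsetI) (auto intro: trancl_trans)
    from less.hyps[OF this u(3)] obtain a' b' where 2: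
      "(u, a') \<in> (local_edges (r u))\<^sup>*" "(a', b') \<in> E" "(b', w) \<in> (local_edges (r w))\<^sup>*" by blast
    \<comment> \<open>When both ends have the same role, the crossing edge is local as well, so the
      half whose ends agree becomes a local path that can be glued to the other half.\<close>
    have step: "(x, y) \<in> (local_edges (r x))\<^sup>*"
      if "r x = r y" "(x, c) \<in> (local_edges (r x))\<^sup>*" "(c, d) \<in> E" "(d, y) \<in> (local_edges (r y))\<^sup>*"
      for x y c d
    proof -
      have "(c, d) \<in> local_edges (r x)"
        using that local_rtrancl_role[OF that(2)] local_rtrancl_role[OF that(4)]
        by (auto simp: local_edges_def)
      then show ?thesis using that by (metis rtrancl.rtrancl_into_rtrancl rtrancl_trans)
    qed
    show ?thesis
    proof (cases "r u = r v")
      case True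
      then show ?thesis using step[of v u a b] 1 2 by (metis rtrancl_trans)
    next
      case False
      then have "r u = r w" using u by simp
      then show ?thesis using step[of u w a' b'] 1 2 by (metis rtrancl_trans)
    qed
  qed
qed

text \<open>All three pieces of \<open>role_factorization\<close> lie in the same role. This turns
  causality in the full graph into causality in the graph of one signer, where \<open>honest\<close>
  demands closedness.\<close>

lemma local_path:
  assumes "(v, w) \<in> E\<^sup>*" "r v = r w"
  shows "(v, w) \<in> (local_edges (r w))\<^sup>*"
proof (cases "v = w")
  case False
  then have "(v, w) \<in> E\<^sup>+" using assms(1) by (simp add: rtrancl_eq_or_trancl)
  then obtain a b where ab: "(v, a) \<in> (local_edges (r w))\<^sup>*" "(a, b) \<in> E"
      "(b, w) \<in> (local_edges (r w))\<^sup>*"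
    using role_factorization assms(2) by metis
  then have "(a, b) \<in> local_edges (r w)"
    using local_rtrancl_role[OF ab(1)] local_rtrancl_role[OF ab(3)] assms(2)
    by (auto simp: local_edges_def)
  then show ?thesis using ab by (meson rtrancl.rtrancl_into_rtrancl rtrancl_trans)
qed simp


subsection \<open>Received messages and abort chains\<close>

lemma K_precD:
  assumes "(x, y) \<in> K_prec v"
  shows "(x, y) \<in> E" "is_message (\<mu> (x, y))" "(y, v) \<in> E\<^sup>+" "r y = r v" "r x \<noteq> r v"
    "x \<in> V - {v\<^sub>T}"
  using assms message_iff edge_source unfolding K_prec_def K_def by auto

lemma K_precI:
  "(x, y) \<in> E \<Longrightarrow> is_message (\<mu> (x, y)) \<Longrightarrow> (y, v) \<in> E\<^sup>+ \<Longrightarrow> r y = r v \<Longrightarrow> (x, y) \<in> K_prec v"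
  unfolding K_prec_def K_def by auto

section \<open>Monotonicity of knowledge within a role\<close>

lemma K_mono: "(v, w) \<in> E\<^sup>* \<Longrightarrow> r v = r w \<Longrightarrow> K v \<subseteq> K w"
  unfolding K_def by auto

lemma K_prec_mono: "(v, w) \<in> E\<^sup>* \<Longrightarrow> r v = r w \<Longrightarrow> K_prec v \<subseteq> K_prec w"
  unfolding K_prec_def K_def by auto

text \<open>Going back within a role only removes received messages. Since all senders belong to
  \<open>A\<close>, a set of senders that fell short of \<open>A\<close> still does.\<close>

lemma InitSet_antimono:
  assumes "w \<in> InitSet" "(v, w) \<in> E\<^sup>*" "r v = r w"
  shows "v \<in> InitSet"
proof -
  have w: "w \<in> V" "w \<noteq> v\<^sub>T" using assms(1) by (auto simp: InitSet_def)
  then have v: "v \<in> V" "v \<noteq> v\<^sub>T"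
    using rtrancl_in_V[OF assms(2)] signer_iff assms(3) by metis+
  have "{r x | x y. (x, y) \<in> K_prec w} \<union> {r w} \<subseteq> A"
    using K_precD(6) signer_roles w by blast
  moreover have "{r x | x y. (x, y) \<in> K_prec v} \<subseteq> {r x | x y. (x, y) \<in> K_prec w}"
    using K_prec_mono assms by blast
  ultimately have "{r x | x y. (x, y) \<in> K_prec v} \<union> {r v} = A \<Longrightarrow>
      {r x | x y. (x, y) \<in> K_prec w} \<union> {r w} = A"
    unfolding assms(3) by (intro subset_antisym) blast+
  then show ?thesis using assms(1) v unfolding InitSet_def by blast
qed

text \<open>Dually, going forward within a role only adds received signatures, and the roles of
  their senders never leave \<open>A\<close>.\<close>

lemma EndSet_mono:
  assumes "v \<in> EndSet" "(v, w) \<in> E\<^sup>*" "r v = r w" "w \<in> V"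
  shows "w \<in> EndSet"
proof -
  have v: "v \<in> V" "v \<noteq> v\<^sub>T" using assms(1) by (auto simp: EndSet_def)
  then have w: "w \<noteq> v\<^sub>T" using signer_iff assms by metis
  have "{r x | x y. (x, y) \<in> K w \<and> x \<in> active_SigSet} \<subseteq> A"
    using edge_source signer_roles by (fastforce simp: K_def)
  moreover have "r w \<in> A" using w assms signer_roles by simp
  moreover have "{r x | x y. (x, y) \<in> K v \<and> x \<in> active_SigSet}
      \<subseteq> {r x | x y. (x, y) \<in> K w \<and> x \<in> active_SigSet}"
    using K_mono assms by blast
  ultimately have "{r x | x y. (x, y) \<in> K v \<and> x \<in> active_SigSet} \<union> {r v} = A \<Longrightarrow>
      {r x | x y. (x, y) \<in> K w \<and> x \<in> active_SigSet} \<union> {r w} = A"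
    unfolding assms(3) by (intro subset_antisym) blast+
  then show ?thesis using assms(1,4) w unfolding EndSet_def by blast
qed

lemma hon_iff:
  "hon v I \<longleftrightarrow> (\<forall>u\<in>I. \<forall>(x, y)\<in>K_prec u. r x = r v \<longrightarrow> (v, x) \<notin> E\<^sup>*)"
  unfolding hon_def K_prec_set_def by auto

lemma hon_antimono: "hon v I \<Longrightarrow> J \<subseteq> I \<Longrightarrow> hon v J"
  unfolding hon_iff by blast

text \<open>Message edges join different roles, so no message received by \<open>r v\<close> was
  sent by \<open>r v\<close>.\<close>

lemma hon_self: "hon v {v}"
  unfolding hon_iff using K_precD(5) by blast

text \<open>This is the part of an AC sequence that concerns the TTP, grown one request at a time so
  that inductions can follow the order in which requests are handled.\<close>

inductive abort_chain :: "'v list \<Rightarrow> bool" where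
  single: "v \<in> InitSet \<Longrightarrow> abort_chain [v]"
| snoc: "abort_chain vs \<Longrightarrow> r v \<notin> r ` set vs \<Longrightarrow> hon v (insert v (set vs)) \<Longrightarrow>
    hon (last vs) (insert v (set vs)) \<Longrightarrow> abort_chain (vs @ [v])"

lemma abort_chain_nonempty: "abort_chain vs \<Longrightarrow> vs \<noteq> []"
  by (induction rule: abort_chain.induct) auto

lemma abort_chain_single_iff: "abort_chain [v] \<longleftrightarrow> v \<in> InitSet"
proof
  assume "abort_chain [v]"
  then show "v \<in> InitSet"
    by cases (auto dest: abort_chain_nonempty)
qed (rule abort_chain.single)

lemma abort_chain_snoc_iff:
  "vs \<noteq> [] \<Longrightarrow> abort_chain (vs @ [v]) \<longleftrightarrow> abort_chain vs \<and> r v \<notin> r ` set vs \<and>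
     hon v (insert v (set vs)) \<and> hon (last vs) (insert v (set vs))"
  (is "_ \<Longrightarrow> _ \<longleftrightarrow> ?R")
proof
  assume "vs \<noteq> []" and "abort_chain (vs @ [v])"
  from this(2) this(1) show ?R by cases auto
qed (blast intro: abort_chain.snoc)

lemma abort_chain_distinct: "abort_chain vs \<Longrightarrow> distinct (map r vs)"
  by (induction rule: abort_chain.induct) auto

text \<open>An earlier vertex of the same role presents no new messages, so nothing new can
  incriminate the vertex before it in the chain. The honesty of \<open>v\<close> itself is assumed,
  since an earlier vertex may precede more messages.\<close>

lemma abort_chain_replace_last:
  assumes "abort_chain (vs @ [w])" "r v = r w" "(v, w) \<in> E\<^sup>*" "hon v (insert v (set vs))"
  shows "abort_chain (vs @ [v])"
proof (cases "vs = []")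
  case True
  then show ?thesis using assms InitSet_antimono by (simp add: abort_chain_single_iff)
next
  case False
  have "hon (last vs) (insert v (set vs))" if "hon (last vs) (insert w (set vs))"
    using that K_prec_mono[OF assms(3,2)] unfolding hon_iff by blast
  then show ?thesis using assms False by (simp add: abort_chain_snoc_iff)
qed

text \<open>Replaces all vertices of a chain at once; \<open>hon\<close> has to be transported only
  for subsets of the chain because only prefixes are ever tested.\<close>

lemma abort_chain_map:
  assumes "abort_chain vs"
    and "\<And>v. v \<in> set vs \<Longrightarrow> r (f v) = r v"
    and "\<And>v. v \<in> set vs \<Longrightarrow> v \<in> InitSet \<Longrightarrow> f v \<in> InitSet"
    and "\<And>v I. v \<in> set vs \<Longrightarrow> I \<subseteq> set vs \<Longrightarrow> hon v I \<Longrightarrow> hon (f v) (f ` I)"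
  shows "abort_chain (map f vs)"
  using assms
proof (induction rule: abort_chain.induct)
  case (single v)
  then show ?case by (auto intro: abort_chain.single)
next
  case (snoc vs v)
  have ne: "vs \<noteq> []" using snoc.hyps abort_chain_nonempty by auto
  have "abort_chain (map f vs)"
  proof (rule snoc.IH)
    show "hon (f u) (f ` I)" if "u \<in> set vs" "I \<subseteq> set vs" "hon u I" for u I
      using snoc.prems(3)[of u I] that by auto
  qed (use snoc.prems(1,2) in auto)
  moreover have "r (f v) \<notin> r ` f ` set vs"
    using snoc.prems(1) snoc.hyps(2) by (force simp: image_iff)
  moreover have "hon (f v) (insert (f v) (f ` set vs))"
    using snoc.prems(3)[of v "insert v (set vs)"] snoc.hyps by auto
  moreover have "hon (f (last vs)) (insert (f v) (f ` set vs))"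
    using snoc.prems(3)[of "last vs" "insert v (set vs)"] snoc.hyps ne by auto
  ultimately show ?case
    using ne by (auto simp: abort_chain_snoc_iff last_map)
qed

lemma abort_chain_iff:
  "abort_chain vs \<longleftrightarrow> vs \<noteq> [] \<and> hd vs \<in> InitSet \<and> distinct (map r vs) \<and>
     (\<forall>i\<in>{1..length vs}. hon (vs ! (i - 1)) (set (take i vs)) \<and>
        (2 \<le> i \<longrightarrow> hon (vs ! (i - 2)) (set (take i vs))))"
proof (induction vs rule: rev_induct)
  case Nil
  then show ?case by (auto dest: abort_chain_nonempty)
next
  case (snoc v vs)
  show ?case
  proof (cases "vs = []")
    case True
    then show ?thesis using hon_self by (simp add: abort_chain_single_iff)
  next
    case False
    let ?P = "\<lambda>vs i. hon (vs ! (i - 1)) (set (take i vs)) \<and>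
        (2 \<le> i \<longrightarrow> hon (vs ! (i - 2)) (set (take i vs)))"
    have len: "length vs \<ge> 1" using False by (cases vs) auto
    have "?P (vs @ [v]) i \<longleftrightarrow> ?P vs i" if "i \<in> {1..length vs}" for i
      using that by (auto simp: nth_append)
    \<comment> \<open>For the full list, positions \<open>i - 1\<close> and \<open>i - 2\<close> are
      the new vertex and the former last one.\<close>
    moreover have "?P (vs @ [v]) (Suc (length vs)) \<longleftrightarrow>
        hon v (insert v (set vs)) \<and> hon (last vs) (insert v (set vs))"
      using len False by (auto simp: nth_append last_conv_nth)
    moreover have "{1..length (vs @ [v])} = insert (Suc (length vs)) {1..length vs}"
      by auto
    ultimately have "(\<forall>i\<in>{1..length (vs @ [v])}. ?P (vs @ [v]) i) \<longleftrightarrow>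
        (\<forall>i\<in>{1..length vs}. ?P vs i) \<and> hon v (insert v (set vs)) \<and> hon (last vs) (insert v (set vs))"
      by (metis (no_types, lifting) insert_iff)
    moreover have "distinct (map r (vs @ [v])) \<longleftrightarrow> distinct (map r vs) \<and> r v \<notin> r ` set vs"
      by auto
    moreover have "hd (vs @ [v]) = hd vs" "vs @ [v] \<noteq> []" using False by auto
    ultimately show ?thesis
      unfolding abort_chain_snoc_iff[OF False] snoc.IH using False by argo
  qed
qed

text \<open>Moves between the indexed definition and \<open>abort_chain\<close>. The bound by
  \<open>card A\<close> comes from the roles being distinct elements of \<open>A\<close>.\<close>

lemma AC_sequence_iff:
  "AC_sequence vs s \<longleftrightarrow> set vs \<subseteq> V - {v\<^sub>T} \<and> abort_chain vs \<and>
     (\<forall>v\<in>V. (v, last vs) \<in> E\<^sup>+ \<and> r v = r (last vs) \<longrightarrow> v \<notin> EndSet) \<and>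
     s \<in> active_SigSet - EndSet \<and> r s = r (last vs) \<and> (last vs, s) \<notin> E\<^sup>*"
proof -
  have len: "length vs \<le> card A" if "distinct (map r vs)" "set vs \<subseteq> V - {v\<^sub>T}"
  proof -
    have "set (map r vs) \<subseteq> A" using that signer_roles by auto
    then show ?thesis
      using distinct_card[OF that(1)] card_mono[OF finite_A] by (metis length_map)
  qed
  have dist: "distinct (map r vs) \<longleftrightarrow>
      (\<forall>i<length vs. \<forall>j<length vs. i \<noteq> j \<longrightarrow> r (vs ! i) \<noteq> r (vs ! j))"
    by (auto simp: distinct_conv_nth)
  have ne: "1 \<le> length vs \<longleftrightarrow> vs \<noteq> []" by (cases vs) auto
  show ?thesis
    unfolding AC_sequence_def abort_chain_iff dist[symmetric] ne using len by argo
qed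


subsection \<open>The TTP on well-formed requests\<close>

lemma abort_neq_signatures: "abort \<noteq> signatures"
  using abort_not_list unfolding signatures_def by auto

lemma promise_by_request:
  "v \<in> V - {v\<^sub>T} \<Longrightarrow> promise_by (request v) P w \<longleftrightarrow> P = r v \<and> w = v"
  unfolding promise_by_def request_def inj_eq[OF msg_list_inject]
  using signer_roles by (auto dest: promise_inject)

text \<open>By \<open>promise_by_request\<close> a request determines its issuer and vertex, which
  settles the definite description. Only the tests for an earlier conviction and an earlier request
  remain.\<close>

lemma ttp_step_request:
  assumes "v \<in> V - {v\<^sub>T}"
  shows "ttp_step (request v) st =
    (if r v \<in> dishonest st \<or> r v \<in> r ` evidence st
     then (abort, st\<lparr>dishonest := insert (r v) (dishonest st)\<rparr>)
     else (decision (ttp_accept (r v) v st), ttp_accept (r v) v st))"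
proof -
  have "(THE (P, w). promise_by (request v) P w) = (r v, v)"
    by (rule the_equality) (auto simp: promise_by_request[OF assms])
  moreover have "\<exists>P w. promise_by (request v) P w"
    using promise_by_request[OF assms] by auto
  moreover have "\<not> (\<forall>w\<in>V. request v \<noteq> request w)" using assms by auto
  moreover have "r v \<in> r ` evidence st \<longleftrightarrow> (\<exists>w\<in>evidence st. r w = r v)" by (metis image_iff)
  ultimately show ?thesis unfolding ttp_step_def by (auto simp: Let_def)
qed

lemma evidence_ttp_accept: "evidence (ttp_accept P v st) = insert v (evidence st)"
  by (simp add: ttp_accept_def Let_def)

lemma dishonest_ttp_accept:
  "dishonest (ttp_accept P v st) = (if v \<in> InitSet then dishonest st else dishonest st \<union>
     {r w | w. w \<in> insert v (evidence st) \<and> \<not> hon w (insert v (evidence st))})"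
  by (simp add: ttp_accept_def Let_def)

text \<open>The witness \<open>w\<close> is what links consecutive members of an abort chain, hence
  the existential form with the updated \<open>dishonest\<close> field.\<close>

lemma decision_ttp_accept:
  "decision (ttp_accept P v st) =
     (if v \<in> InitSet \<or> (\<exists>w\<in>insert v (evidence st).
         r w \<notin> dishonest (ttp_accept P v st) \<and> r w \<noteq> P)
      then decision st else signatures)"
proof (cases "v \<in> InitSet")
  case False
  let ?I = "insert v (evidence st)" and ?D = "dishonest (ttp_accept P v st)"
  have "decision (ttp_accept P v st) =
      (if \<forall>w\<in>?I. r w \<notin> ?D \<longrightarrow> r w = P then signatures else decision st)"
    using False unfolding dishonest_ttp_accept by (simp only: ttp_accept_def Let_def) simp
  then show ?thesis using False by (simp only:) auto
qed (simp add: ttp_accept_def Let_def)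

lemma ttp_run_Nil: "ttp_run [] = ttp_init"
  by (simp add: ttp_run_def)

lemma ttp_run_snoc: "ttp_run (ms @ [m]) = snd (ttp_step m (ttp_run ms))"
  by (simp add: ttp_run_def)

lemma \<delta>_snoc: "\<delta> (ms @ [m]) = fst (ttp_step m (ttp_run ms))"
  using ttp_procedure[of "ms @ [m]"] by (simp add: ttp_reply_def)


subsection \<open>Executions\<close>

lemma execution_step:
  "execution ss as \<Longrightarrow> i < length as \<Longrightarrow> step (ss ! i) (as ! i) (ss ! Suc i)"
  by (simp add: execution_def)

lemma step_mono: "step s \<alpha> s' \<Longrightarrow> s \<subseteq> s'"
  unfolding step_def by (cases \<alpha>) auto

lemma execution_mono:
  assumes "execution ss as" "i \<le> j" "j \<le> length as"
  shows "ss ! i \<subseteq> ss ! j"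
  using assms(2,3)
proof (induction rule: dec_induct)
  case (step n)
  then show ?case using step_mono[OF execution_step[OF assms(1), of n]] by auto
qed simp

lemma execution_last: "execution ss as \<Longrightarrow> last ss = ss ! length as"
  unfolding execution_def by (metis Suc_neq_Zero diff_Suc_1 last_conv_nth length_0_conv)

lemma step_exit:
  assumes "step s Exit_step s'"
  shows "\<exists>v\<in>V - {v\<^sub>T}. s' = insert (Edge (v, v\<^sub>T)) s \<and> Edge (v, v\<^sub>T) \<notin> s"
proof -
  from assms obtain v w where "(v, w) \<in> E" "\<mu> (v, w) = Exit" "s' = s \<union> {Edge (v, w)}" "s \<noteq> s'"
    unfolding step_def by auto
  then show ?thesis using exit_iff edge_source by (intro bexI[of _ v]) auto
qed

text \<open>The new item of an exit step is unique, which resolves the definite description in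
  \<open>exit_vertex\<close>.\<close>

lemma execution_exit:
  assumes "execution ss as" "i < length as" "as ! i = Exit_step"
  shows "exit_vertex ss i \<in> V - {v\<^sub>T}"
    "ss ! Suc i = insert (Edge (exit_vertex ss i, v\<^sub>T)) (ss ! i)"
    "Edge (exit_vertex ss i, v\<^sub>T) \<notin> ss ! i"
proof -
  obtain v where v: "v \<in> V - {v\<^sub>T}" "ss ! Suc i = insert (Edge (v, v\<^sub>T)) (ss ! i)"
      "Edge (v, v\<^sub>T) \<notin> ss ! i"
    using step_exit execution_step[OF assms(1,2)] assms(3) by metis
  have "exit_vertex ss i = v"
    unfolding exit_vertex_def v(2) by (rule the_equality) (use v(3) in auto)
  then show "exit_vertex ss i \<in> V - {v\<^sub>T}"
    "ss ! Suc i = insert (Edge (exit_vertex ss i, v\<^sub>T)) (ss ! i)"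
    "Edge (exit_vertex ss i, v\<^sub>T) \<notin> ss ! i"
    using v by auto
qed

lemma requests_0: "requests ss as 0 = []"
  by (simp add: requests_def)

lemma requests_Suc:
  "requests ss as (Suc n) =
     requests ss as n @ (if as ! n = Exit_step then [request (exit_vertex ss n)] else [])"
  by (simp add: requests_def)

text \<open>Closedness is only available in the graph of \<open>P\<close>, so
  \<open>local_path\<close> first moves the path from \<open>v\<close> to \<open>x\<close> into it.
  A message edge is not an exit edge, so it survives the removal of the exit edge in the third
  honesty clause.\<close>

lemma honest_state_executed:
  assumes "honest_state P s" "v \<in> V - {v\<^sub>T}" "r v = P" "(v, x) \<in> E\<^sup>*" "r x = P"
    "(x, y) \<in> E" "is_message (\<mu> (x, y))" "Edge (x, y) \<in> s"
  shows "Vertex v \<in> s"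
proof -
  define s' where "s' = s \<inter> items (role_verts P) (role_edges P)"
  have v: "v \<in> role_verts P"
    using exit_edges[OF assms(2)] assms(3) unfolding role_verts_def role_edges_def by force
  have xy: "Edge (x, y) \<in> s'"
    using assms unfolding s'_def items_def role_edges_def by auto
  have "local_edges P \<subseteq> role_edges P" by (auto simp: local_edges_def role_edges_def)
  then have "(v, x) \<in> (role_edges P)\<^sup>*"
    using local_path[OF assms(4)] assms rtrancl_mono by auto
  then have closed: "Vertex v \<in> S"
    if "causally_closed (role_verts P) (role_edges P) S" "Edge (x, y) \<in> S" for S
    using that v unfolding causally_closed_def items_def by auto
  show ?thesis
  proof (cases "{e \<in> E. \<mu> e = Exit \<and> Edge e \<in> s'} = {}")
    case True
    then have "causally_closed (role_verts P) (role_edges P) s'"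
      using assms(1) unfolding honest_state_def s'_def[symmetric] Let_def by auto
    then show ?thesis using closed xy s'_def by auto
  next
    case False
    then obtain a b where ab: "(a, b) \<in> E" "\<mu> (a, b) = Exit" "Edge (a, b) \<in> s'" by auto
    then have "causally_closed (role_verts P) (role_edges P) (s' - {Edge (a, b)})"
      using assms(1) unfolding honest_state_def s'_def[symmetric] Let_def by auto
    moreover have "(x, y) \<noteq> (a, b)" using ab assms(7) by (auto simp: is_message_def)
    ultimately show ?thesis using closed xy s'_def by auto
  qed
qed

lemma honest_state_exit:
  assumes "honest_state P s" "v \<in> V - {v\<^sub>T}" "r v = P" "Edge (v, v\<^sub>T) \<in> s"
  shows "Vertex v \<notin> s"
    and "w \<in> V - {v\<^sub>T} \<Longrightarrow> r w = P \<Longrightarrow> Edge (w, v\<^sub>T) \<in> s \<Longrightarrow> w = v"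
proof -
  define s' where "s' = s \<inter> items (role_verts P) (role_edges P)"
  have exit: "(u, v\<^sub>T) \<in> {e \<in> E. \<mu> e = Exit \<and> Edge e \<in> s'} \<and> u \<in> role_verts P"
    if "u \<in> V - {v\<^sub>T}" "r u = P" "Edge (u, v\<^sub>T) \<in> s" for u
    using that exit_edges[OF that(1)] exit_iff[of u "v\<^sub>T"]
    unfolding s'_def role_verts_def items_def role_edges_def by force
  note v = exit[OF assms(2-4)]
  have "Vertex v \<notin> s'"
    using assms(1) v unfolding honest_state_def s'_def[symmetric] Let_def by blast
  then show "Vertex v \<notin> s" using v unfolding s'_def items_def by auto
  show "w = v" if "w \<in> V - {v\<^sub>T}" "r w = P" "Edge (w, v\<^sub>T) \<in> s"
    using assms(1) v exit[OF that] unfolding honest_state_def s'_def[symmetric] Let_def by blast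
qed


subsection \<open>Unfair executions yield abort-chaining sequences\<close>

context
  fixes ss as P
  assumes exec: "execution ss as" and signer: "P \<in> A"
    and honest: "honest P ss" and unforged: "unforged P ss as"
begin

abbreviation ttp_at :: "nat \<Rightarrow> ('v, 'p, 'm) ttp_state" where
  "ttp_at n \<equiv> ttp_run (requests ss as n)"

lemma honest_last: "honest_state P (last ss)"
  using honest exec unfolding honest_def execution_def by (metis last_in_set length_0_conv nat.distinct(1))

lemma state_subset_last: "i \<le> length as \<Longrightarrow> ss ! i \<subseteq> last ss"
  using execution_mono[OF exec] execution_last[OF exec] by simp

lemma exit_edge_last:
  "i < length as \<Longrightarrow> as ! i = Exit_step \<Longrightarrow> Edge (exit_vertex ss i, v\<^sub>T) \<in> last ss"
  using execution_exit(2)[OF exec, of i] state_subset_last[of "Suc i"] by auto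

text \<open>Honesty leaves one possible exit edge of \<open>P\<close>, and a transition must change
  the state, so this edge cannot be taken twice.\<close>

lemma exit_unique:
  assumes "i < length as" "as ! i = Exit_step" "r (exit_vertex ss i) = P"
    and "j < length as" "as ! j = Exit_step" "r (exit_vertex ss j) = P"
  shows "i = j"
proof -
  have lt: False
    if "i < j" "i < length as" "as ! i = Exit_step" "r (exit_vertex ss i) = P"
      "j < length as" "as ! j = Exit_step" "r (exit_vertex ss j) = P" for i j
  proof -
    have "exit_vertex ss j = exit_vertex ss i"
      using honest_state_exit(2)[OF honest_last] execution_exit(1)[OF exec] exit_edge_last that
      by metis
    moreover have "Edge (exit_vertex ss i, v\<^sub>T) \<in> ss ! j"
      using execution_exit(2)[OF exec that(2,3)] execution_mono[OF exec, of "Suc i" j] that by auto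
    ultimately show False using execution_exit(3)[OF exec that(5,6)] by simp
  qed
  show ?thesis using lt[of i j] lt[of j i] assms by (metis linorder_neqE_nat)
qed

text \<open>A message of \<open>P\<close> sent after \<open>w\<close> and shown to the TTP was
  really sent, by \<open>unforged\<close>; closedness would then have executed
  \<open>w\<close>.\<close>

lemma hon_unexecuted:
  assumes "w \<in> V - {v\<^sub>T}" "r w = P" "Vertex w \<notin> last ss"
    and "I \<subseteq> {exit_vertex ss i | i. i < length as \<and> as ! i = Exit_step}"
  shows "hon w I"
  unfolding hon_iff
proof (intro ballI, clarify)
  fix u x y
  assume u: "u \<in> I" and xy: "(x, y) \<in> K_prec u" "r x = r w" and wx: "(w, x) \<in> E\<^sup>*"
  from u assms(4) obtain i where i: "i < length as" "as ! i = Exit_step" "u = exit_vertex ss i"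
    by auto
  then have "Edge (x, y) \<in> ss ! i"
    using unforged xy assms(2) unfolding unforged_def by auto
  then have "Edge (x, y) \<in> last ss" using state_subset_last[of i] i(1) by auto
  then have "Vertex w \<in> last ss"
    using honest_state_executed[OF honest_last assms(1,2) wx] xy K_precD(1,2)[OF xy(1)] assms(2)
    by auto
  then show False using assms(3) by simp
qed

section \<open>TTP states along the execution\<close>

lemma ttp_at_Suc:
  assumes "n < length as"
  shows "ttp_at (Suc n) =
    (if as ! n = Exit_step then
       (let u = exit_vertex ss n in
        if r u \<in> dishonest (ttp_at n) \<or> r u \<in> r ` evidence (ttp_at n)
        then (ttp_at n)\<lparr>dishonest := insert (r u) (dishonest (ttp_at n))\<rparr>
        else ttp_accept (r u) u (ttp_at n))
     else ttp_at n)"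
  using ttp_step_request[OF execution_exit(1)[OF exec assms], of "ttp_at n"]
  by (simp add: requests_Suc ttp_run_snoc Let_def)

lemma evidence_subset:
  "n \<le> length as \<Longrightarrow> evidence (ttp_at n) \<subseteq> {exit_vertex ss i | i. i < n \<and> as ! i = Exit_step}"
proof (induction n)
  case 0
  then show ?case by (simp add: requests_0 ttp_run_Nil ttp_init_def)
next
  case (Suc n)
  have "evidence (ttp_at (Suc n)) \<subseteq>
      evidence (ttp_at n) \<union> {u. u = exit_vertex ss n \<and> as ! n = Exit_step}"
    using Suc.prems by (auto simp: ttp_at_Suc Let_def evidence_ttp_accept)
  moreover have "evidence (ttp_at n) \<subseteq> {exit_vertex ss i | i. i < n \<and> as ! i = Exit_step}"
    using Suc by simp
  moreover have "\<dots> \<subseteq> {exit_vertex ss i | i. i < Suc n \<and> as ! i = Exit_step}"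
    by (blast intro: less_SucI)
  moreover have "{u. u = exit_vertex ss n \<and> as ! n = Exit_step} \<subseteq> \<dots>"
    by (blast intro: lessI)
  ultimately show ?case by blast
qed

lemma signer_fresh:
  assumes "n < length as" "as ! n = Exit_step" "r (exit_vertex ss n) = P"
  shows "P \<notin> r ` evidence (ttp_at n)"
proof
  assume "P \<in> r ` evidence (ttp_at n)"
  then obtain j where j: "j < n" "as ! j = Exit_step" "r (exit_vertex ss j) = P"
    using evidence_subset[of n] assms(1) by auto
  then show False using exit_unique[of j n] assms by auto
qed

text \<open>A conviction needs a second request of \<open>P\<close> or a request of \<open>P\<close>
  refuted by evidence. The first is excluded by \<open>signer_fresh\<close>, the second because an
  exit vertex of \<open>P\<close> stays unexecuted, so that \<open>hon_unexecuted\<close>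
  applies.\<close>

lemma signer_not_dishonest: "n \<le> length as \<Longrightarrow> P \<notin> dishonest (ttp_at n)"
proof (induction n)
  case 0
  then show ?case by (simp add: requests_0 ttp_run_Nil ttp_init_def)
next
  case (Suc n)
  have ev: "evidence (ttp_at n) \<subseteq> {exit_vertex ss i | i. i < n \<and> as ! i = Exit_step}"
    using evidence_subset Suc.prems by simp
  show ?case
  proof (cases "as ! n = Exit_step")
    case True
    let ?u = "exit_vertex ss n" and ?I = "insert (exit_vertex ss n) (evidence (ttp_at n))"
    have "r ?u \<noteq> P" if "r ?u \<in> r ` evidence (ttp_at n)"
      using that signer_fresh[of n] True Suc.prems by auto
    moreover have "hon w ?I" if w: "w \<in> ?I" "r w = P" for w
    proof -
      have I: "?I \<subseteq> {exit_vertex ss i | i. i < length as \<and> as ! i = Exit_step}"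
        using ev True Suc.prems by force
      then obtain i where i: "i < length as" "as ! i = Exit_step" "w = exit_vertex ss i"
        using w(1) by blast
      have wV: "w \<in> V - {v\<^sub>T}" using execution_exit(1)[OF exec i(1,2)] i(3) by simp
      have "Vertex w \<notin> last ss"
        using honest_state_exit(1)[OF honest_last wV w(2)] exit_edge_last[OF i(1,2)] i(3) by simp
      then show ?thesis by (rule hon_unexecuted[OF wV w(2) _ I])
    qed
    ultimately show ?thesis
      using Suc True by (auto simp: ttp_at_Suc Let_def dishonest_ttp_accept)
  next
    case False
    then show ?thesis using Suc by (simp add: ttp_at_Suc)
  qed
qed

lemma decision_cases: "n \<le> length as \<Longrightarrow> decision (ttp_at n) \<in> {abort, signatures}"
proof (induction n)
  case 0
  then show ?case by (simp add: requests_0 ttp_run_Nil ttp_init_def)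
next
  case (Suc n)
  then show ?case by (auto simp: ttp_at_Suc Let_def decision_ttp_accept)
qed

lemma decision_mono:
  assumes "m \<le> n" "n \<le> length as" "decision (ttp_at m) = signatures"
  shows "decision (ttp_at n) = signatures"
  using assms
proof (induction rule: dec_induct)
  case (step n)
  then show ?case by (auto simp: ttp_at_Suc Let_def decision_ttp_accept)
qed simp

text \<open>Induction over time, with \<open>w\<close> arbitrary because the chain is continued
  backwards from a different vertex. A request in \<open>InitSet\<close> starts a chain; otherwise
  some other request has prevented the signatures and is put in front.\<close>

lemma abort_chain_exists:
  assumes "n \<le> length as" "decision (ttp_at n) = abort"
    and "w \<in> evidence (ttp_at n)" "hon w (evidence (ttp_at n))"
  shows "\<exists>vs. abort_chain (vs @ [w]) \<and> insert w (set vs) \<subseteq> evidence (ttp_at n)"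
  using assms
proof (induction n arbitrary: w)
  case 0
  then show ?case by (simp add: requests_0 ttp_run_Nil ttp_init_def)
next
  case (Suc n)
  let ?u = "exit_vertex ss n"
  have abort: "decision (ttp_at n) = abort"
    using decision_cases[of n] decision_mono[of n "Suc n"] Suc.prems abort_neq_signatures by auto
  show ?case
  proof (cases "evidence (ttp_at (Suc n)) = evidence (ttp_at n)")
    case True
    then show ?thesis using Suc abort by auto
  next
    case False
    then have acc: "ttp_at (Suc n) = ttp_accept (r ?u) ?u (ttp_at n)"
        and fresh: "r ?u \<notin> r ` evidence (ttp_at n)"
      using Suc.prems(1) ttp_at_Suc[of n] by (auto simp: Let_def split: if_splits)
    have ev: "evidence (ttp_at (Suc n)) = insert ?u (evidence (ttp_at n))"
      by (simp add: acc evidence_ttp_accept)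
    have IH: "\<exists>vs. abort_chain (vs @ [w]) \<and> insert w (set vs) \<subseteq> evidence (ttp_at n)"
      if "w \<in> evidence (ttp_at n)" "hon w (evidence (ttp_at (Suc n)))" for w
      using Suc.IH[OF _ abort that(1)] Suc.prems(1) hon_antimono[OF that(2)] ev by auto
    show ?thesis
    proof (cases "w = ?u")
      case False
      then show ?thesis using IH[of w] Suc.prems ev by auto
    next
      case True
      show ?thesis
      proof (cases "w \<in> InitSet")
        case True
        then show ?thesis using Suc.prems(3) abort_chain.single by (intro exI[of _ "[]"]) auto
      next
        case False
        \<comment> \<open>\<open>z\<close> is the witness that kept the decision at abort; having
          another role, it was in evidence before.\<close>
        then obtain z where z: "z \<in> evidence (ttp_at (Suc n))"
            "r z \<notin> dishonest (ttp_at (Suc n))" "r z \<noteq> r ?u"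
          using Suc.prems(2) abort_neq_signatures \<open>w = ?u\<close> decision_ttp_accept[of "r ?u" ?u "ttp_at n"]
          unfolding acc evidence_ttp_accept by (auto split: if_splits)
        then have z': "z \<in> evidence (ttp_at n)" using ev by auto
        \<comment> \<open>Outside \<open>InitSet\<close> the TTP tests all evidence, so an
          unconvicted \<open>z\<close> passes the test on the enlarged set.\<close>
        have hz: "hon z (evidence (ttp_at (Suc n)))"
          using z(1,2) False \<open>w = ?u\<close> dishonest_ttp_accept[of "r ?u" ?u "ttp_at n"]
          unfolding acc evidence_ttp_accept by auto
        from IH[OF z' hz] obtain vs where vs: "abort_chain (vs @ [z])"
            "insert z (set vs) \<subseteq> evidence (ttp_at n)" by blast
        have sub: "insert w (set (vs @ [z])) \<subseteq> evidence (ttp_at (Suc n))"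
          using vs(2) ev \<open>w = ?u\<close> by auto
        have "abort_chain ((vs @ [z]) @ [w])"
        proof (rule abort_chain.snoc[OF vs(1)])
          show "r w \<notin> r ` set (vs @ [z])" using fresh vs(2) \<open>w = ?u\<close> by auto
          show "hon w (insert w (set (vs @ [z])))" using hon_antimono[OF Suc.prems(4) sub] .
          show "hon (last (vs @ [z])) (insert w (set (vs @ [z])))"
            using hon_antimono[OF hz sub] by simp
        qed
        then show ?thesis using sub by blast
      qed
    qed
  qed
qed

lemma AC_sequence_of_unfair:
  assumes unfair: "\<not> fair_for P ss as"
  shows "\<exists>vs s. AC_sequence vs s"
proof -
  from unfair obtain v i where i: "r v = P" "i < length as" "as ! i = Exit_step"
      "Edge (v, v\<^sub>T) \<in> ss ! Suc i - ss ! i" "reply ss as i = abort"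
    unfolding fair_for_def by blast
  have v: "v = exit_vertex ss i" using i(4) execution_exit(2)[OF exec i(2,3)] by auto
  have vV: "v \<in> V - {v\<^sub>T}" using execution_exit(1)[OF exec i(2,3)] v by simp
  have not_end: "u \<notin> EndSet" if "Vertex u \<in> last ss" "r u = P" for u
    using unfair that unfolding fair_for_def by blast
  have v_last: "Vertex v \<notin> last ss"
    using honest_state_exit(1)[OF honest_last vV i(1)] exit_edge_last[OF i(2,3)] v by simp
  have "r v \<notin> r ` evidence (ttp_at i)" using signer_fresh[of i] i v by simp
  moreover have "r v \<notin> dishonest (ttp_at i)" using signer_not_dishonest[of i] i by simp
  ultimately have acc: "ttp_at (Suc i) = ttp_accept (r v) v (ttp_at i)"
      and rep: "decision (ttp_at (Suc i)) = abort"
    using i ttp_step_request[OF vV, of "ttp_at i"] ttp_at_Suc[OF i(2)] v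
    by (auto simp: Let_def reply_def requests_Suc \<delta>_snoc)
  \<comment> \<open>Once accepted, \<open>v\<close> itself is an unconvicted witness against
    signatures in every later request, all of which come from other signers.\<close>
  have later: "v \<in> evidence (ttp_at n) \<and> decision (ttp_at n) = abort"
    if "Suc i \<le> n" "n \<le> length as" for n
    using that
  proof (induction rule: dec_induct)
    case base
    then show ?case using rep acc by (simp add: evidence_ttp_accept)
  next
    case (step n)
    then have IH: "v \<in> evidence (ttp_at n)" "decision (ttp_at n) = abort" and n: "n < length as"
      by auto
    show ?case
    proof (cases "as ! n = Exit_step")
      case True
      have "r (exit_vertex ss n) \<noteq> P" using exit_unique[OF n True _ i(2,3)] i(1) v step.hyps by auto
      then show ?thesis
        using IH signer_not_dishonest[of "Suc n"] n ttp_at_Suc[OF n] i(1)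
        by (auto simp: Let_def evidence_ttp_accept decision_ttp_accept)
    next
      case False
      then show ?thesis using IH n by (simp add: ttp_at_Suc)
    qed
  qed
  \<comment> \<open>At earlier times, a decision for signatures would have persisted past the abort
    at step \<open>i\<close>.\<close>
  have aborts: "decision (ttp_at n) = abort" if "n \<le> length as" for n
  proof (cases "Suc i \<le> n")
    case True
    then show ?thesis using later that by blast
  next
    case False
    then show ?thesis
      using decision_mono[of n "Suc i"] decision_cases[of n] rep i(2) abort_neq_signatures by auto
  qed
  have "reply ss as j \<noteq> signatures" if j: "j < length as" "as ! j = Exit_step" for j
    using aborts[of "Suc j"] j abort_neq_signatures ttp_at_Suc[OF j(1)]
      ttp_step_request[OF execution_exit(1)[OF exec j], of "ttp_at j"]
    by (auto simp: Let_def reply_def requests_Suc \<delta>_snoc)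
  then obtain s x where s: "(s, x) \<in> E" "is_message (\<mu> (s, x))" "Edge (s, x) \<in> last ss" "r s = P"
      "s \<in> active_SigSet"
    using unfair unfolding fair_for_def by blast
  have executed_s: "Vertex u \<in> last ss" if "u \<in> V - {v\<^sub>T}" "r u = P" "(u, s) \<in> E\<^sup>*" for u
    using honest_state_executed[OF honest_last that s(4,1,2,3)] .
  text \<open>An honest \<open>P\<close> may exit at \<open>v\<close> although predecessors of \<open>v\<close> have not been executed, and
    some of those may lie in \<open>EndSet\<close>; the first one that has not been executed takes the place
    of \<open>v\<close>.\<close>
  obtain v' where v': "(v', v) \<in> E\<^sup>*" "r v' = P" "Vertex v' \<notin> last ss"
      and min: "\<And>u. (u, v') \<in> E\<^sup>+ \<Longrightarrow> r u = P \<Longrightarrow> Vertex u \<in> last ss"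
  proof -
    let ?Q = "{u. (u, v) \<in> E\<^sup>* \<and> r u = P \<and> Vertex u \<notin> last ss}"
    have "v \<in> ?Q" using i(1) v_last by simp
    from wfE_min[OF wf_prec this] obtain u where u: "u \<in> ?Q"
        "\<And>y. (y, u) \<in> E\<^sup>+ \<Longrightarrow> y \<notin> ?Q" by blast
    show ?thesis
    proof (rule that)
      fix y assume y: "(y, u) \<in> E\<^sup>+" "r y = P"
      then have "(y, v) \<in> E\<^sup>*" using u(1) by (auto dest: trancl_into_rtrancl intro: rtrancl_trans)
      then show "Vertex y \<in> last ss" using u(2)[OF y(1)] y(2) by blast
    qed (use u(1) in auto)
  qed
  have v'V: "v' \<in> V - {v\<^sub>T}"
    using rtrancl_in_V[OF v'(1)] vV v'(2) signer signer_iff by blast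
  let ?I = "evidence (ttp_at (Suc i))"
  have I: "?I \<subseteq> {exit_vertex ss i | i. i < length as \<and> as ! i = Exit_step}"
    using evidence_subset[of "Suc i"] i(2) by fastforce
  have "hon v ?I" using hon_unexecuted[OF vV i(1) v_last I] .
  then obtain vs where vs: "abort_chain (vs @ [v])" "insert v (set vs) \<subseteq> ?I"
    using abort_chain_exists[of "Suc i" v] later[of "Suc i"] i(2) by auto
  have "hon v' (insert v (set vs))"
    using hon_antimono[OF hon_unexecuted[OF v'V v'(2,3) I] vs(2)] .
  \<comment> \<open>The set to be tested exchanges \<open>v\<close> for \<open>v'\<close>; the
    messages presented by \<open>v'\<close> itself are harmless by \<open>hon_self\<close>.\<close>
  then have "hon v' (insert v' (set vs))"
    using hon_self[of v'] unfolding hon_iff by blast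
  then have "abort_chain (vs @ [v'])"
    using abort_chain_replace_last[OF vs(1)] v' i(1) by simp
  moreover have "set (vs @ [v']) \<subseteq> V - {v\<^sub>T}"
    using v'V vs(2) I execution_exit(1)[OF exec] by fastforce
  \<comment> \<open>\<open>s\<close> has been executed because its signature was sent; by unfairness
    it is then not in \<open>EndSet\<close>. For the same reason the unexecuted \<open>v'\<close>
    cannot precede \<open>s\<close>.\<close>
  moreover have "s \<notin> EndSet" using executed_s[of s] not_end s edge_source by blast
  ultimately have "AC_sequence (vs @ [v']) s"
    unfolding AC_sequence_iff using min not_end s executed_s[OF v'V v'(2)] v' by auto
  then show ?thesis by blast
qed

end


subsection \<open>Abort-chaining sequences yield unfair executions\<close>

lemma abort_chain_hon_last: "abort_chain vs \<Longrightarrow> hon (last vs) (set vs)"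
  by (cases rule: abort_chain.cases) (auto simp: hon_self)

text \<open>In the execution built from an abort-chaining sequence, the victim \<open>P\<close> has to send all of
  its messages that the \<open>v\<^sub>i\<close> present to the TTP, and may reach \<open>EndSet\<close> by doing so. To avoid
  this, a \<open>v\<^sub>i\<close> that has received a message sent by \<open>P\<close> from \<open>EndSet\<close> is replaced by the first
  vertex at which this happened.\<close>

lemma AC_sequence_clean:
  assumes "AC_sequence vs s"
  obtains ws where "AC_sequence ws s"
    "\<And>v x y. v \<in> set ws \<Longrightarrow> (x, y) \<in> K_prec v \<Longrightarrow> r x = r (last ws) \<Longrightarrow> x \<notin> EndSet"
proof -
  define P where "P = r (last vs)"
  define clean where "clean v \<longleftrightarrow> (\<forall>(x, y)\<in>K_prec v. r x = P \<longrightarrow> x \<notin> EndSet)" for v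
  have AC: "set vs \<subseteq> V - {v\<^sub>T}" "abort_chain vs"
      "\<And>v. v \<in> V \<Longrightarrow> (v, last vs) \<in> E\<^sup>+ \<Longrightarrow> r v = P \<Longrightarrow> v \<notin> EndSet"
      "s \<in> active_SigSet - EndSet" "r s = P" "(last vs, s) \<notin> E\<^sup>*"
    using assms unfolding AC_sequence_iff P_def by auto
  have ne: "vs \<noteq> []" using abort_chain_nonempty[OF AC(2)] .
  have last_unique: "u = last vs" if "u \<in> set vs" "r u = P" for u
    using that abort_chain_distinct[OF AC(2)] last_in_set[OF ne] unfolding P_def distinct_map
    by (meson inj_onD)
  \<comment> \<open>A changed vertex remembers a culprit: a message from \<open>P\<close> in
    \<open>EndSet\<close> received exactly at the new vertex.\<close>
  let ?ok = "\<lambda>v w. (w, v) \<in> E\<^sup>* \<and> r w = r v \<and> clean w \<and>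
      (w = v \<or> (\<exists>x. (x, w) \<in> K_prec v \<and> r x = P \<and> x \<in> EndSet))"
  have "\<exists>w. ?ok v w" for v
  proof (cases "clean v")
    case False
    let ?Q = "{y. \<exists>x. (x, y) \<in> K_prec v \<and> r x = P \<and> x \<in> EndSet}"
    from False obtain y\<^sub>0 where y\<^sub>0: "y\<^sub>0 \<in> ?Q" unfolding clean_def by auto
    \<comment> \<open>Such a message in \<open>K_prec w\<close> would have a receiver before
      \<open>w\<close>, against minimality; hence \<open>w\<close> is clean.\<close>
    from wfE_min[OF wf_prec y\<^sub>0] obtain w where w: "w \<in> ?Q"
        and min: "\<And>y. (y, w) \<in> E\<^sup>+ \<Longrightarrow> y \<notin> ?Q" by blast
    have wv: "(w, v) \<in> E\<^sup>+" "r w = r v" using w K_precD(3,4) by auto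
    have "clean w"
      unfolding clean_def
    proof (intro ballI, clarify)
      fix x y assume xy: "(x, y) \<in> K_prec w" "x \<in> EndSet" "P = r x"
      have "(x, y) \<in> K_prec v"
        using xy(1) K_prec_mono[OF trancl_into_rtrancl[OF wv(1)] wv(2)] by blast
      then show False using min[of y] K_precD(3)[OF xy(1)] xy by blast
    qed
    then show ?thesis using w wv by (intro exI[of _ w]) auto
  qed blast
  then obtain f where f: "\<And>v. ?ok v (f v)" by metis
  have K_f: "K_prec (f v) \<subseteq> K_prec v" for v using f[of v] K_prec_mono by blast
  \<comment> \<open>The victim's own vertex never moves, since \<open>P\<close> receives no messages
    from \<open>P\<close>.\<close>
  have f_last: "f (last vs) = last vs"
    using f[of "last vs"] K_precD(5)[of _ "f (last vs)" "last vs"] unfolding P_def by auto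
  have "abort_chain (map f vs)"
  proof (rule abort_chain_map[OF AC(2)])
    show "r (f v) = r v" for v using f by blast
    show "f v \<in> InitSet" if "v \<in> InitSet" for v using that f InitSet_antimono by blast
    show "hon (f v) (f ` I)" if v: "v \<in> set vs" and I: "I \<subseteq> set vs" and hon: "hon v I" for v I
      unfolding hon_iff
    proof (intro ballI, clarify)
      fix u q z
      assume u: "u \<in> I" and qz: "(q, z) \<in> K_prec (f u)" "r q = r (f v)" and fq: "(f v, q) \<in> E\<^sup>*"
      have "(q, z) \<in> K_prec u" "r q = r v" using qz K_f f[of v] by auto
      \<comment> \<open>An unmoved vertex would already violate \<open>hon v I\<close>. A moved one
        brings the culprit \<open>x\<close>, which precedes \<open>z\<close> via \<open>f v\<close>
        and \<open>q\<close>.\<close>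
      then have "f v \<noteq> v" using hon u fq unfolding hon_iff by force
      then obtain x where x: "(x, f v) \<in> K_prec v" "r x = P" "x \<in> EndSet" using f[of v] by blast
      have z: "(q, z) \<in> E" "(z, f u) \<in> E\<^sup>+" "r z = r (f u)" using K_precD[OF qz(1)] by auto
      have xz: "(x, z) \<in> E\<^sup>+" using K_precD(1)[OF x(1)] fq z(1) by auto
      have xV: "x \<in> V" using x(3) by (auto simp: EndSet_def)
      show False
      proof (cases "r z = P")
        case True
        \<comment> \<open>Then \<open>x\<close> is an \<open>EndSet\<close> vertex of
          \<open>P\<close> before the last one, which an AC sequence forbids.\<close>
        then have "u = last vs" using last_unique[of u] u I z(3) f[of u] by auto
        then have "(x, last vs) \<in> E\<^sup>+" using xz z(2) f_last by simp
        then show False using AC(3)[OF xV] x by blast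
      next
        case False
        \<comment> \<open>Factoring the path from \<open>x\<close> to \<open>z\<close> exposes a
          direct message from \<open>P\<close> to the role of \<open>f u\<close>, sent no earlier
          than \<open>x\<close>; its sender is in \<open>EndSet\<close> as well and contradicts the
          cleanness of \<open>f u\<close>.\<close>
        obtain a b where ab: "(x, a) \<in> (local_edges (r x))\<^sup>*" "(a, b) \<in> E"
            "(b, z) \<in> (local_edges (r z))\<^sup>*"
          using role_factorization[OF xz] by blast
        have roles: "r a = P" "r b = r z"
          using local_rtrancl_role[OF ab(1)] local_rtrancl_role[OF ab(3)] x(2) by auto
        have bu: "(b, f u) \<in> E\<^sup>+"
          using local_rtrancl_prec[OF ab(3)] z(2) by (rule rtrancl_trancl_trancl)
        then have "b \<noteq> v\<^sub>T" using v\<^sub>T_sink by (metis tranclD)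
        then have "(a, b) \<in> K_prec (f u)"
          using K_precI[OF ab(2) _ bu] message_iff[OF ab(2)] roles z(3) False by auto
        moreover have "a \<in> EndSet"
          using EndSet_mono[OF x(3) local_rtrancl_prec[OF ab(1)]] roles x(2) edge_in_V[OF ab(2)]
          by auto
        ultimately show False using f[of u] roles(1) unfolding clean_def by auto
      qed
    qed
  qed
  moreover have "set (map f vs) \<subseteq> V - {v\<^sub>T}"
  proof -
    have "f v \<in> V - {v\<^sub>T}" if v: "v \<in> V - {v\<^sub>T}" for v
    proof -
      have fV: "f v \<in> V" "r (f v) = r v" using rtrancl_in_V f[of v] v by auto
      then show ?thesis using signer_iff[OF fV(1)] signer_roles[OF v] by simp
    qed
    then show ?thesis using AC(1) by auto
  qed
  moreover have "last (map f vs) = last vs" using f_last ne by (simp add: last_map)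
  ultimately have "AC_sequence (map f vs) s" and "r (last (map f vs)) = P"
    using AC unfolding AC_sequence_iff P_def by auto
  moreover have "x \<notin> EndSet" if "v \<in> set (map f vs)" "(x, y) \<in> K_prec v" "r x = P" for v x y
    using that f unfolding clean_def by auto
  ultimately show thesis using that by metis
qed

text \<open>Each new request meets its predecessor in the chain as an unconvicted signer of another
  role, so the decision stays at abort. The bound on \<open>dishonest\<close> is carried along to
  see that neither this predecessor nor the new signer is convicted.\<close>

lemma abort_chain_ttp_run:
  assumes "abort_chain vs" "set vs \<subseteq> V - {v\<^sub>T}"
  shows "\<delta> (map request vs) = abort \<and> decision (ttp_run (map request vs)) = abort \<and>
    evidence (ttp_run (map request vs)) = set vs \<and>
    dishonest (ttp_run (map request vs)) \<subseteq> r ` {w \<in> set vs. \<not> hon w (set vs)}"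
  using assms
proof (induction rule: abort_chain.induct)
  case (single v)
  then show ?case
    using ttp_step_request[of v ttp_init] \<delta>_snoc[of "[]" "request v"] ttp_run_snoc[of "[]" "request v"]
    by (simp add: ttp_run_Nil ttp_init_def evidence_ttp_accept decision_ttp_accept dishonest_ttp_accept)
next
  case (snoc vs v)
  let ?st = "ttp_run (map request vs)" and ?I = "insert v (set vs)"
  let ?st' = "ttp_accept (r v) v ?st"
  have v: "v \<in> V - {v\<^sub>T}" and st: "decision ?st = abort" "evidence ?st = set vs"
      "dishonest ?st \<subseteq> r ` {w \<in> set vs. \<not> hon w (set vs)}"
    using snoc.IH snoc.prems by auto
  have dis: "dishonest ?st' \<subseteq> r ` {w \<in> ?I. \<not> hon w ?I}"
  proof -
    have "{w \<in> set vs. \<not> hon w (set vs)} \<subseteq> {w \<in> ?I. \<not> hon w ?I}"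
      using hon_antimono[of _ ?I "set vs"] by auto
    from image_mono[OF this, of r] show ?thesis
      using st(2,3) unfolding dishonest_ttp_accept by auto
  qed
  have last: "last vs \<in> set vs" using abort_chain_nonempty[OF snoc.hyps(1)] by simp
  \<comment> \<open>Distinct roles let a convicted role be traced back to a single vertex.\<close>
  have inj: "inj_on r ?I"
    using abort_chain_distinct[OF snoc.hyps(1)] snoc.hyps(2) by (auto simp: distinct_map)
  have "r (last vs) \<notin> dishonest ?st'"
  proof
    assume "r (last vs) \<in> dishonest ?st'"
    then obtain w where w: "w \<in> ?I" "\<not> hon w ?I" "r (last vs) = r w" using dis by auto
    then have "last vs = w" using inj_onD[OF inj w(3)] last by blast
    then show False using w(2) snoc.hyps(4) by simp
  qed
  moreover have "r (last vs) \<noteq> r v" using snoc.hyps(2) last by (metis imageI)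
  ultimately have "decision ?st' = abort"
    using last st(1,2) unfolding decision_ttp_accept by auto
  moreover have "ttp_step (request v) ?st = (decision ?st', ?st')"
    using ttp_step_request[OF v, of ?st] snoc.hyps(2) st by auto
  ultimately show ?case
    using dis st(2) by (simp add: \<delta>_snoc ttp_run_snoc evidence_ttp_accept)
qed

section \<open>Assembling executions step by step\<close>

lemma execution_Nil: "execution [{}] []"
  by (simp add: execution_def)

lemma execution_snoc:
  assumes "execution ss as" "step (last ss) \<alpha> s"
  shows "execution (ss @ [s]) (as @ [\<alpha>])"
  using assms execution_last[OF assms(1)] unfolding execution_def
  by (auto simp: nth_append less_Suc_eq)

lemma exit_vertex_append:
  "Suc i < length ss \<Longrightarrow> exit_vertex (ss @ ts) i = exit_vertex ss i"
  by (simp add: exit_vertex_def nth_append)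

lemma requests_append:
  assumes "length ss = Suc (length as)" "n \<le> length as"
  shows "requests (ss @ ts) (as @ bs) n = requests ss as n"
  using assms(2)
proof (induction n)
  case (Suc n)
  then show ?case using assms(1) by (simp add: requests_Suc nth_append exit_vertex_append)
qed (simp add: requests_0)

definition exits :: "'v set \<Rightarrow> 'v item set" where
  "exits X = (\<lambda>v. Edge (v, v\<^sub>T)) ` X"

lemma finite_closed:
  assumes "causally_closed V E D"
  shows "finite D"
proof -
  have "finite (items V E)" using finite_E finite_V by (simp add: items_def)
  then show ?thesis using assms finite_subset unfolding causally_closed_def by blast
qed

text \<open>An edge of \<open>D\<close> whose target is missing is maximal, since anything after it
  would force the target into \<open>D\<close>. If there is none, every edge of \<open>D\<close> has
  its target in \<open>D\<close>, and a causally last vertex is maximal.\<close>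

lemma closed_maximal:
  assumes closed: "causally_closed V E D" and "D \<noteq> {}"
  shows "\<exists>x\<in>D. \<forall>y\<in>D. \<not> prec E x y"
proof -
  have D: "D \<subseteq> items V E" "\<And>x y. x \<in> D \<Longrightarrow> y \<in> items V E \<Longrightarrow> prec E y x \<Longrightarrow> y \<in> D"
    using closed unfolding causally_closed_def by auto
  have src: "Vertex v \<in> D" if "Edge (v, w) \<in> D" for v w
    using D(2)[OF that, of "Vertex v"] that D(1) edge_in_V by (auto simp: items_def)
  show ?thesis
  proof (cases "\<exists>v w. Edge (v, w) \<in> D \<and> Vertex w \<notin> D")
    case True
    then obtain v w where vw: "Edge (v, w) \<in> D" "Vertex w \<notin> D" by blast
    then have w: "Vertex w \<in> items V E" using D(1) edge_in_V by (auto simp: items_def)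
    have "\<not> prec E (Edge (v, w)) y" if "y \<in> D" for y
    proof
      assume pr: "prec E (Edge (v, w)) y"
      have "Vertex w = y \<or> prec E (Vertex w) y"
      proof (cases y)
        case (Vertex u)
        then show ?thesis using pr by (auto simp: rtrancl_eq_or_trancl)
      next
        case (Edge e)
        then show ?thesis using pr by (cases e) auto
      qed
      then show False using D(2)[OF that w] vw(2) that by auto
    qed
    then show ?thesis using vw(1) by blast
  next
    case False
    let ?W = "{v. Vertex v \<in> D}"
    obtain x where x: "x \<in> D" using assms(2) by blast
    have "\<exists>v\<^sub>0. v\<^sub>0 \<in> ?W"
    proof (cases x)
      case (Edge e)
      then show ?thesis using x src by (cases e) auto
    qed (use x in auto)
    then obtain v where v: "v \<in> ?W" "\<And>w. (w, v) \<in> (E\<inverse>)\<^sup>+ \<Longrightarrow> w \<notin> ?W"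
      using wfE_min[OF wf_succ] by metis
    then have v_max: "(v, w) \<notin> E\<^sup>+" if "w \<in> ?W" for w
      using that by (auto simp: trancl_converse)
    have "\<not> prec E (Vertex v) y" if y: "y \<in> D" for y
    proof (cases y)
      case (Vertex u)
      then show ?thesis using v_max[of u] y by auto
    next
      case (Edge e)
      obtain a b where e: "e = (a, b)" by (cases e)
      have "(a, b) \<in> E" "Vertex b \<in> D" using y Edge e D(1) False by (auto simp: items_def)
      then show ?thesis using v_max[of b] Edge e by (auto dest: rtrancl_into_trancl1)
    qed
    then show ?thesis using v(1) by blast
  qed
qed

text \<open>A maximal item is taken away and executed last; everything it requires is in the rest by
  closedness. Each state being closed is what later yields honesty.\<close>

lemma execution_to_closed:
  assumes "causally_closed V E D" "\<And>v. Edge (v, v\<^sub>T) \<notin> D"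
  shows "\<exists>ss as. execution ss as \<and> last ss = D \<and> Exit_step \<notin> set as \<and>
    (\<forall>s\<in>set ss. s \<subseteq> D \<and> causally_closed V E s)"
  using assms
proof (induction "card D" arbitrary: D rule: less_induct)
  case less
  show ?case
  proof (cases "D = {}")
    case True
    then show ?thesis using execution_Nil less.prems(1)
      by (intro exI[of _ "[{}]"] exI[of _ "[]"]) auto
  next
    case False
    obtain x where x: "x \<in> D" "\<And>y. y \<in> D \<Longrightarrow> \<not> prec E x y"
      using closed_maximal[OF less.prems(1) False] by blast
    let ?D = "D - {x}"
    have D: "D \<subseteq> items V E" "\<And>x y. x \<in> D \<Longrightarrow> y \<in> items V E \<Longrightarrow> prec E y x \<Longrightarrow> y \<in> D"
      using less.prems(1) unfolding causally_closed_def by auto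
    have closed: "causally_closed V E ?D" using D x(2) unfolding causally_closed_def by blast
    have "card ?D < card D" using x(1) finite_closed[OF less.prems(1)] by (intro card_Diff1_less)
    from less.hyps[OF this closed] less.prems(2) obtain ss as where
      ss: "execution ss as" "last ss = ?D" "Exit_step \<notin> set as"
        "\<forall>s\<in>set ss. s \<subseteq> ?D \<and> causally_closed V E s" by auto
    have "\<exists>\<alpha>. \<alpha> \<noteq> Exit_step \<and> step ?D \<alpha> D"
    proof (cases x)
      case (Vertex v)
      have "{Edge (u, v) | u. (u, v) \<in> E} \<subseteq> ?D"
        using D(2)[OF x(1)] Vertex by (auto simp: items_def)
      moreover have "v \<in> V" using Vertex x(1) D(1) by (auto simp: items_def)
      ultimately have "step ?D Recv_step D"
        using x(1) Vertex unfolding step_def by (auto intro!: bexI[of _ v])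
      then show ?thesis by blast
    next
      case (Edge e)
      obtain v w where e: "e = (v, w)" by (cases e)
      have vw: "(v, w) \<in> E" using Edge e x(1) D(1) by (auto simp: items_def)
      have D': "?D \<noteq> D" "D = ?D \<union> {Edge (v, w)}" using x(1) Edge e by auto
      show ?thesis
      proof (cases "\<mu> (v, w)")
        case (Msg m)
        then have "step ?D Send_step D"
          using vw D' unfolding step_def is_message_def by auto
        then show ?thesis by blast
      next
        case Eps
        have "Vertex v \<in> ?D"
          using D(2)[OF x(1), of "Vertex v"] Edge e vw edge_in_V by (auto simp: items_def)
        then have "step ?D Eps_step D" using vw D' Eps unfolding step_def by auto
        then show ?thesis by blast
      next
        case Exit
        then show ?thesis using exit_iff[OF vw] less.prems(2) x(1) Edge e by auto
      qed
    qed
    then obtain \<alpha> where "\<alpha> \<noteq> Exit_step" "step ?D \<alpha> D" by blast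
    then have "execution (ss @ [D]) (as @ [\<alpha>])" "Exit_step \<notin> set (as @ [\<alpha>])"
      using execution_snoc[OF ss(1)] ss(2,3) by auto
    moreover have "\<forall>s\<in>set (ss @ [D]). s \<subseteq> D \<and> causally_closed V E s"
      using ss(4) less.prems(1) by auto
    ultimately show ?thesis by (metis last_snoc)
  qed
qed

text \<open>All of \<open>D\<close> is executed before the first exit, then one exit per vertex in
  the order of \<open>vs\<close>. The shape of the states serves \<open>honest\<close>, the
  inclusion of \<open>D\<close> at exits serves \<open>unforged\<close>, and the last clause locates
  the victim's exit.\<close>

lemma execution_exits:
  assumes closed: "causally_closed V E D" "\<And>v. Edge (v, v\<^sub>T) \<notin> D"
    and "distinct vs" "set vs \<subseteq> V - {v\<^sub>T}"
  shows "\<exists>ss as. execution ss as \<and> last ss = D \<union> exits (set vs) \<and>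
    requests ss as (length as) = map request vs \<and>
    (\<forall>s\<in>set ss. \<exists>D' X. D' \<subseteq> D \<and> causally_closed V E D' \<and> X \<subseteq> set vs \<and> s = D' \<union> exits X) \<and>
    (\<forall>i<length as. as ! i = Exit_step \<longrightarrow> exit_vertex ss i \<in> set vs \<and> D \<subseteq> ss ! i) \<and>
    (vs \<noteq> [] \<longrightarrow> (\<exists>i. length as = Suc i \<and> as ! i = Exit_step \<and> exit_vertex ss i = last vs))"
  using assms(3,4)
proof (induction vs rule: rev_induct)
  case Nil
  obtain ss as where ss: "execution ss as" "last ss = D" "Exit_step \<notin> set as"
      "\<forall>s\<in>set ss. s \<subseteq> D \<and> causally_closed V E s"
    using execution_to_closed[OF closed] by blast
  have "filter (\<lambda>i. as ! i = Exit_step) [0..<length as] = []"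
    using ss(3) by (auto simp: filter_empty_conv) (metis nth_mem)
  then have "requests ss as (length as) = []" by (simp add: requests_def)
  moreover have "as ! i \<noteq> Exit_step" if "i < length as" for i using ss(3) nth_mem[OF that] by metis
  ultimately show ?case
    using ss by (intro exI[of _ ss] exI[of _ as]) (auto simp: exits_def)
next
  case (snoc v vs)
  then obtain ss as where ss: "execution ss as" "last ss = D \<union> exits (set vs)"
      "requests ss as (length as) = map request vs"
      "\<forall>s\<in>set ss. \<exists>D' X. D' \<subseteq> D \<and> causally_closed V E D' \<and> X \<subseteq> set vs \<and> s = D' \<union> exits X"
      "\<forall>i<length as. as ! i = Exit_step \<longrightarrow> exit_vertex ss i \<in> set vs \<and> D \<subseteq> ss ! i"
    by auto
  let ?s = "D \<union> exits (set (vs @ [v]))"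
  let ?ss = "ss @ [?s]" and ?as = "as @ [Exit_step]"
  have v: "v \<in> V - {v\<^sub>T}" "v \<notin> set vs" using snoc.prems by auto
  have len: "length ss = Suc (length as)" using ss(1) by (simp add: execution_def)
  have s: "?s = last ss \<union> {Edge (v, v\<^sub>T)}" "Edge (v, v\<^sub>T) \<notin> last ss"
    using ss(2) v(2) closed(2) by (auto simp: exits_def)
  then have "step (last ss) Exit_step ?s"
    unfolding step_def using exit_edges[OF v(1)] exit_iff by auto
  from execution_snoc[OF ss(1) this] have exec: "execution ?ss ?as" .
  have ex: "exit_vertex ?ss (length as) = v"
  proof -
    have "?ss ! length as = last ss" "?ss ! Suc (length as) = ?s"
      using execution_last[OF ss(1)] len by (auto simp: nth_append)
    then have "insert (Edge (v, v\<^sub>T)) (last ss) =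
        insert (Edge (exit_vertex ?ss (length as), v\<^sub>T)) (last ss)"
      using execution_exit(2)[OF exec, of "length as"] s(1) by simp
    then have "Edge (v, v\<^sub>T) = Edge (exit_vertex ?ss (length as), v\<^sub>T)"
      using s(2) by (metis insertE insertI1)
    then show ?thesis by simp
  qed
  have "requests ?ss ?as (length ?as) = map request (vs @ [v])"
    using requests_append[OF len, of "length as"] ss(3) ex by (simp add: requests_Suc)
  moreover have "\<exists>D' X. D' \<subseteq> D \<and> causally_closed V E D' \<and> X \<subseteq> set (vs @ [v]) \<and> t = D' \<union> exits X"
    if t: "t \<in> set ?ss" for t
  proof (cases "t = ?s")
    case True
    then show ?thesis using closed(1) by blast
  next
    case False
    then have "t \<in> set ss" using t by simp
    from bspec[OF ss(4) this] obtain D' X where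
      "D' \<subseteq> D" "causally_closed V E D'" "X \<subseteq> set vs" "t = D' \<union> exits X"
      by (elim exE conjE)
    then show ?thesis by (intro exI[of _ D'] exI[of _ X]) (simp add: subset_insertI2)
  qed
  moreover have "exit_vertex ?ss i \<in> set (vs @ [v]) \<and> D \<subseteq> ?ss ! i"
    if "i < length ?as" "?as ! i = Exit_step" for i
  proof (cases "i = length as")
    case True
    then show ?thesis using ex ss(2) len execution_last[OF ss(1)] by (auto simp: nth_append)
  next
    case False
    then have i: "i < length as" using that by simp
    then show ?thesis
      using that(2) ss(5) len exit_vertex_append[of i ss] by (auto simp: nth_append)
  qed
  moreover have "\<exists>i. length ?as = Suc i \<and> ?as ! i = Exit_step \<and> exit_vertex ?ss i = last (vs @ [v])"
    using ex by simp
  ultimately show ?case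
    using exec by (intro exI[of _ ?ss] exI[of _ ?as] conjI allI impI ballI) simp_all
qed

text \<open>Closedness passes to the graph of \<open>P\<close>, whose causality is contained in the
  global one. Exit edges of other signers lie outside that graph, so removing the exit at
  \<open>v\<^sub>0\<close> leaves just the part of \<open>D\<close>.\<close>

lemma honest_state_exits:
  assumes "P \<in> A" "causally_closed V E D" "\<And>v. Edge (v, v\<^sub>T) \<notin> D"
    and X: "X \<subseteq> V - {v\<^sub>T}" "\<And>v. v \<in> X \<Longrightarrow> r v = P \<Longrightarrow> v = v\<^sub>0" and v\<^sub>0: "Vertex v\<^sub>0 \<notin> D"
  shows "honest_state P (D \<union> exits X)"
proof -
  let ?items = "items (role_verts P) (role_edges P)"
  let ?ex = "{e \<in> E. \<mu> e = Exit \<and> Edge e \<in> (D \<union> exits X) \<inter> ?items}"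
  have sub: "role_edges P \<subseteq> E" by (auto simp: role_edges_def)
  have mono: "prec E x y" if "prec (role_edges P) x y" for x y
    using that rtrancl_mono[OF sub] trancl_mono[OF _ sub]
    by (induction E x y rule: prec.induct) auto
  have "?items \<subseteq> items V E"
    using sub E_subset unfolding items_def role_verts_def by fastforce
  then have closed: "causally_closed (role_verts P) (role_edges P) (D \<inter> ?items)"
    using assms(2) mono unfolding causally_closed_def by blast
  \<comment> \<open>As \<open>P\<close> is not the role of the target \<open>v\<^sub>T\<close>, an
    exit edge belongs to \<open>P\<close> only through its source.\<close>
  have P: "P \<noteq> T" using assms(1) T_notin_A by auto
  have role: "r v = P" if "Edge (v, v\<^sub>T) \<in> ?items" for v
    using that P role_v\<^sub>T by (auto simp: items_def role_edges_def)
  have ex: "?ex \<subseteq> {(v\<^sub>0, v\<^sub>T)}"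
  proof clarify
    fix v w assume e: "(v, w) \<in> E" "\<mu> (v, w) = Exit" "Edge (v, w) \<in> D \<union> exits X" "Edge (v, w) \<in> ?items"
    then have w: "w = v\<^sub>T" using exit_iff by blast
    then have "v \<in> X" using e(3) assms(3) by (auto simp: exits_def)
    then show "v = v\<^sub>0 \<and> w = v\<^sub>T" using X(2) role e(4) w by blast
  qed
  have exits: "exits X \<inter> ?items \<subseteq> Edge ` ?ex"
    using X(1) exit_edges exit_iff by (fastforce simp: exits_def)
  show ?thesis
  proof (cases "?ex = {}")
    case True
    then have "(D \<union> exits X) \<inter> ?items = D \<inter> ?items" using exits unfolding True by auto
    then show ?thesis using closed unfolding honest_state_def Let_def True by simp
  next
    case False
    then have ex': "?ex = {(v\<^sub>0, v\<^sub>T)}" using ex by blast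
    have "(D \<union> exits X) \<inter> ?items - {Edge (v\<^sub>0, v\<^sub>T)} = D \<inter> ?items"
      using exits assms(3) unfolding ex' by auto
    moreover have "Vertex v\<^sub>0 \<notin> (D \<union> exits X) \<inter> ?items" using v\<^sub>0 by (auto simp: exits_def)
    ultimately show ?thesis using closed unfolding honest_state_def Let_def ex' by simp
  qed
qed

text \<open>For \<open>F \<subseteq> E\<close> this is the least causally closed set containing the
  edges in \<open>F\<close>; the targets of these edges need not belong to it.\<close>

definition past :: "('v \<times> 'v) set \<Rightarrow> 'v item set" where
  "past F = Vertex ` {v \<in> V. \<exists>(x, y)\<in>F. (v, x) \<in> E\<^sup>*} \<union>
     Edge ` {(a, b) \<in> E. (a, b) \<in> F \<or> (\<exists>(x, y)\<in>F. (b, x) \<in> E\<^sup>*)}"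

lemma past_closed:
  assumes "F \<subseteq> E"
  shows "causally_closed V E (past F)"
  unfolding causally_closed_def
proof (intro conjI ballI impI)
  show "past F \<subseteq> items V E" by (auto simp: past_def items_def)
next
  fix p q assume p: "p \<in> past F" and q: "q \<in> items V E" and prec: "prec E q p"
  \<comment> \<open>\<open>z\<close> is \<open>p\<close> itself or the source of \<open>p\<close>;
    preceding \<open>p\<close> then implies reaching \<open>z\<close>, which treats all four cases
    of \<open>prec\<close> alike.\<close>
  have "\<exists>x y z. (x, y) \<in> F \<and> (z, x) \<in> E\<^sup>* \<and> (case q of Vertex v \<Rightarrow> (v, z) \<in> E\<^sup>* | Edge (a, b) \<Rightarrow> (b, z) \<in> E\<^sup>*)"
  proof (cases p)
    case (Vertex w)
    then obtain x y where "(x, y) \<in> F" "(w, x) \<in> E\<^sup>*" using p by (auto simp: past_def)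
    moreover have "case q of Vertex v \<Rightarrow> (v, w) \<in> E\<^sup>* | Edge (c, d) \<Rightarrow> (d, w) \<in> E\<^sup>*"
      using prec Vertex by (cases q) (auto split: prod.splits)
    ultimately show ?thesis by blast
  next
    case (Edge e)
    obtain a b where e: "e = (a, b)" by (cases e)
    have "(a, b) \<in> E" "(a, b) \<in> F \<or> (\<exists>(x, y)\<in>F. (b, x) \<in> E\<^sup>*)"
      using p Edge e by (auto simp: past_def)
    then obtain x y where "(x, y) \<in> F" "(a, x) \<in> E\<^sup>*"
      by (auto intro: converse_rtrancl_into_rtrancl)
    moreover have "case q of Vertex v \<Rightarrow> (v, a) \<in> E\<^sup>* | Edge (c, d) \<Rightarrow> (d, a) \<in> E\<^sup>*"
      using prec Edge e by (cases q) (auto split: prod.splits)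
    ultimately show ?thesis by blast
  qed
  then obtain x y z where xyz: "(x, y) \<in> F" "(z, x) \<in> E\<^sup>*"
      "case q of Vertex v \<Rightarrow> (v, z) \<in> E\<^sup>* | Edge (a, b) \<Rightarrow> (b, z) \<in> E\<^sup>*"
    by blast
  show "q \<in> past F"
  proof (cases q)
    case (Vertex v)
    then have "(v, x) \<in> E\<^sup>*" using xyz(2,3) by simp
    then show ?thesis using xyz(1) q Vertex by (auto simp: past_def items_def)
  next
    case (Edge e)
    obtain a b where e: "e = (a, b)" by (cases e)
    then have "(b, x) \<in> E\<^sup>*" using xyz(2,3) Edge by simp
    then show ?thesis using xyz(1) q Edge e by (auto simp: past_def items_def)
  qed
qed

lemma not_fair_of_AC_sequence:
  assumes "AC_sequence vs\<^sub>0 s"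
  shows "\<not> fair"
proof -
  obtain vs where AC: "AC_sequence vs s"
      and clean: "\<And>v x y. v \<in> set vs \<Longrightarrow> (x, y) \<in> K_prec v \<Longrightarrow> r x = r (last vs) \<Longrightarrow> x \<notin> EndSet"
    using AC_sequence_clean[OF assms] by metis
  define v where "v = last vs"
  define P where "P = r v"
  have vs: "set vs \<subseteq> V - {v\<^sub>T}" "abort_chain vs"
      and s: "s \<in> active_SigSet" "s \<notin> EndSet" "r s = P" "(v, s) \<notin> E\<^sup>*"
    using AC unfolding AC_sequence_iff P_def v_def by auto
  have ne: "vs \<noteq> []" and dist: "distinct (map r vs)"
    using abort_chain_nonempty[OF vs(2)] abort_chain_distinct[OF vs(2)] by auto
  have v_in: "v \<in> set vs" using ne by (simp add: v_def)
  then have P: "P \<in> A" using vs(1) signer_roles P_def by auto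
  obtain w where w: "(s, w) \<in> E" "is_message (\<mu> (s, w))"
    using s(1) by (auto simp: active_SigSet_def)
  \<comment> \<open>The edge \<open>(s, w)\<close> makes \<open>P\<close> a sender of a signature;
    the messages of \<open>P\<close> that any request presents must be sent for the execution to be
    unforged.\<close>
  define F where "F = insert (s, w) {(x, y) \<in> K_prec_set (set vs). r x = P}"
  \<comment> \<open>Apart from \<open>s\<close>, the sources avoid \<open>EndSet\<close> by
    cleanness and are not preceded by \<open>v\<close> because \<open>v\<close> looks honest with
    respect to the whole chain.\<close>
  have F: "(x, y) \<in> E" "is_message (\<mu> (x, y))" "r x = P" "x \<notin> EndSet" "(v, x) \<notin> E\<^sup>*"
    if xy: "(x, y) \<in> F" for x y
  proof -
    have "(x, y) \<in> E \<and> is_message (\<mu> (x, y)) \<and> r x = P \<and> x \<notin> EndSet \<and> (v, x) \<notin> E\<^sup>*"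
    proof (cases "(x, y) = (s, w)")
      case True
      then show ?thesis using s w by auto
    next
      case False
      then obtain u where u: "u \<in> set vs" "(x, y) \<in> K_prec u" "r x = P"
        using xy by (auto simp: F_def K_prec_set_def)
      then show ?thesis
        using K_precD(1,2)[OF u(2)] clean[OF u(1,2)] abort_chain_hon_last[OF vs(2)]
        unfolding hon_iff P_def v_def by auto
    qed
    then show "(x, y) \<in> E" "is_message (\<mu> (x, y))" "r x = P" "x \<notin> EndSet" "(v, x) \<notin> E\<^sup>*" by auto
  qed
  let ?D = "past F"
  have closed: "causally_closed V E ?D" using F(1) by (intro past_closed) auto
  have no_exit: "Edge (u, v\<^sub>T) \<notin> ?D" for u
  proof
    assume "Edge (u, v\<^sub>T) \<in> ?D"
    then consider "(u, v\<^sub>T) \<in> F" | x y where "(x, y) \<in> F" "(v\<^sub>T, x) \<in> E\<^sup>*"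
      by (auto simp: past_def)
    then show False
    proof cases
      case 1
      then show False using F(1,2) message_iff by blast
    next
      case (2 x y)
      then have "x = v\<^sub>T" using v\<^sub>T_sink by (metis converse_rtranclE)
      then show False using F(1)[OF 2(1)] v\<^sub>T_sink by blast
    qed
  qed
  \<comment> \<open>So \<open>v\<close> stays unexecuted, as an honest exit at \<open>v\<close>
    demands.\<close>
  have v_D: "Vertex v \<notin> ?D" using F(5) by (auto simp: past_def)
  have "distinct vs" using dist by (simp add: distinct_map)
  from execution_exits[OF closed no_exit this vs(1)] ne obtain ss as i where
    exec: "execution ss as" and last: "last ss = ?D \<union> exits (set vs)"
    and req: "requests ss as (length as) = map request vs"
    and states: "\<forall>t\<in>set ss. \<exists>D' X. D' \<subseteq> ?D \<and> causally_closed V E D' \<and> X \<subseteq> set vs \<and> t = D' \<union> exits X"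
    and exits: "\<forall>i<length as. as ! i = Exit_step \<longrightarrow> exit_vertex ss i \<in> set vs \<and> ?D \<subseteq> ss ! i"
    and i: "length as = Suc i" "as ! i = Exit_step" "exit_vertex ss i = v"
    unfolding v_def by auto
  have "honest P ss"
    unfolding honest_def
  proof
    fix t assume "t \<in> set ss"
    from bspec[OF states this] obtain D' X where
      t: "D' \<subseteq> ?D" "causally_closed V E D'" "X \<subseteq> set vs" "t = D' \<union> exits X"
      by (elim exE conjE)
    have "u = v" if "u \<in> X" "r u = P" for u
      using that t(3) v_in dist unfolding P_def distinct_map by (meson inj_onD subsetD)
    moreover have "Edge (u, v\<^sub>T) \<notin> D'" for u using t(1) no_exit by blast
    moreover have "X \<subseteq> V - {v\<^sub>T}" "Vertex v \<notin> D'" using t(1,3) vs(1) v_D by auto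
    ultimately show "honest_state P t"
      unfolding t(4) using honest_state_exits[OF P t(2), of X v] by blast
  qed
  moreover have "unforged P ss as"
    unfolding unforged_def
  proof (intro allI impI ballI, clarify)
    fix j x y assume j: "j < length as" "as ! j = Exit_step" "P = r x"
      and xy: "(x, y) \<in> K_prec (exit_vertex ss j)"
    have "(x, y) \<in> F" using exits j xy by (auto simp: F_def K_prec_set_def)
    then have "Edge (x, y) \<in> ?D" using F(1) by (auto simp: past_def)
    then show "Edge (x, y) \<in> ss ! j" using exits j by blast
  qed
  moreover have "\<not> fair_for P ss as"
  proof -
    have "(s, w) \<in> F" by (simp add: F_def)
    then have "Edge (s, w) \<in> last ss" using last w(1) by (auto simp: past_def)
    then have 1: "\<exists>v w. (v, w) \<in> E \<and> is_message (\<mu> (v, w)) \<and> Edge (v, w) \<in> last ss \<and>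
        r v = P \<and> v \<in> active_SigSet"
      using w s by blast
    \<comment> \<open>A vertex of \<open>P\<close> in \<open>past F\<close> precedes or equals a
      source of \<open>F\<close> in the same role, so \<open>EndSet_mono\<close> would carry
      \<open>EndSet\<close> to that source.\<close>
    have 2: "u \<notin> EndSet" if u: "Vertex u \<in> last ss" "r u = P" for u
    proof -
      have "Vertex u \<in> ?D" using u(1) last by (auto simp: exits_def)
      then obtain x y where xy: "(x, y) \<in> F" "(u, x) \<in> E\<^sup>*" by (auto simp: past_def)
      then show ?thesis using EndSet_mono[of u x] F(3,4)[OF xy(1)] edge_in_V[OF F(1)[OF xy(1)]] u(2)
        by auto
    qed
    \<comment> \<open>The requests up to the exit at \<open>v\<close> are exactly those of the whole
      chain, so this reply is the last answer of the TTP.\<close>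
    have "reply ss as i = abort"
      using abort_chain_ttp_run[OF vs(2,1)] req i(1) by (simp add: reply_def)
    moreover have "Edge (v, v\<^sub>T) \<in> ss ! Suc i - ss ! i" "Edge (v, v\<^sub>T) \<in> last ss"
      using execution_exit(2,3)[OF exec _ i(2)] execution_last[OF exec] i by auto
    ultimately show ?thesis
      unfolding fair_for_def using 1 2 i(1,2) P_def by (metis lessI)
  qed
  ultimately show ?thesis unfolding fair_def using exec P by blast
qed

lemma fair_iff_no_AC_sequence: "fair \<longleftrightarrow> \<not> (\<exists>vs s. AC_sequence vs s)"
  using not_fair_of_AC_sequence AC_sequence_of_unfair unfolding fair_def by blast

end

theorem theorem1:
  fixes R :: "'p set" and T :: 'p
    and V :: "'v set" and E :: "('v \<times> 'v) set"
    and r :: "'v \<Rightarrow> 'p" and \<mu> :: "'v \<times> 'v \<Rightarrow> 'm label" and \<delta> :: "'m list \<Rightarrow> 'm"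
    and promise :: "'p \<Rightarrow> 'c \<Rightarrow> 'v \<Rightarrow> 'p \<Rightarrow> 'p \<Rightarrow> 'm"
    and signature :: "'p \<Rightarrow> 'c \<Rightarrow> 'm"
    and abort :: 'm
    and msg_list :: "'m list \<Rightarrow> 'm"
    and A :: "'p set" and C :: 'c and SigSet :: "'v set"
  assumes "dag_mpcs R T V E r \<mu> \<delta> promise signature abort msg_list A C SigSet"
  shows "contract_setup.fair T V E r \<mu> \<delta> promise signature abort msg_list A C SigSet \<longleftrightarrow>
         \<not> (\<exists>vs s. contract_setup.AC_sequence T V E r \<mu> A SigSet vs s)"
  by (rule dag_mpcs.fair_iff_no_AC_sequence[OF assms])

end
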